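(* (i) If $\int_0^\infty t^{\varepsilon}\pi_\tau(t)\,dt<\infty$ for some $\varepsilon>0$, then the Markov chain produced by Algorithm 2 is geometrically ergodic. (ii) If $\pi_\tau$ is supported in $(0,\overline{\tau^2}]$ for some $0<\overline{\tau^2}<\infty$ (i.e. $\tau^2\le\overline{\tau^2}$ almost surely under the prior), then the Markov chain produced by Algorithm 3 is geometrically ergodic.
   Context: Let $n\ge p\ge 1$, $y\in\mathbb R^n$, $X\in\mathbb R^{n\times p}$ with $X^\top X$ invertible, $a',b'>0$, $\pi_\tau$ a probability density on $(0,\infty)$ and $\pi_\lambda$ a probability density on $\mathbb R$. $\mathrm{IG}(\alpha,\beta)$ is the inverse gamma distribution with density $\propto x^{-\alpha-1}e^{-\beta/x}$. Fix $d>0$ such that $(X^\top X)^{-1}-dI_p$ is positive definite, and put $A=I_p/d+\{(X^\top X)^{-1}-dI_p\}^{-1}$, $b=\{(X^\top X)^{-1}-dI_p\}^{-1}(X^\top X)^{-1}X^\top y$. The state is $(\theta,\tilde\beta,\sigma^2,\tau^2,\lambda)\in\mathbb R^p\times\mathbb R^p\times(0,\infty)\times(0,\infty)\times\mathbb R^p$; write $\Lambda=\mathrm{diag}(\lambda_1,\dots,\lambda_p)$, $\circ$ for the entrywise product, and $R(\tau^2,\lambda)=y^\top[I_n-X\Lambda\{I_p/\tau^2+\Lambda X^\top X\Lambda\}^{-1}\Lambda X^\top]y/2+b'$. (These chains target the posterior of $y_i\sim N(x_i^\top\beta,\sigma^2)$, $\beta_k\sim N(0,\sigma^2\tau^2\lambda_k^2)$,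 $\lambda_k\sim\pi_\lambda$, $\tau^2\sim\pi_\tau$, $\sigma^2\sim\mathrm{IG}(a',b')$, reparametrized by $\tilde\beta_k=\beta_k/(\sqrt{\tau^2}\lambda_k)$ and augmented with a latent $\theta$.) Algorithm 2: one iteration does, in order: (a) independently for $k=1,\dots,p$, draw $\lambda_k$ from the density on $\mathbb R$ proportional to $\lambda\mapsto\exp[-\{\sqrt{\tau^2}\lambda\tilde\beta_k-\theta_k\}^2/(2d\sigma^2)]\pi_\lambda(\lambda)$; (b) draw $\tau^2$ from the density on $(0,\infty)$ proportional to $t\mapsto \pi_\tau(t)\,|I_p+t\Lambda X^\top X\Lambda|^{-1/2}\,R(t,\lambda)^{-(n/2+a')}$; (c) draw $\sigma^2\sim\mathrm{IG}(n/2+a',R(\tau^2,\lambda))$; draw $\tilde\beta\sim N_p\big(\{I_p+\tau^2\Lambda X^\top X\Lambda\}^{-1}\Lambda X^\top y\sqrt{\tau^2},\ \sigma^2\{I_p+\tau^2\Lambda X^\top X\Lambda\}^{-1}\big)$; draw $\theta\sim N_p\big(A^{-1}\{\sqrt{\tau^2}(\lambda\circ\tilde\beta)/d+b\},\ \sigma^2A^{-1}\big)$. Algorithm 3 is identical except that step (b) is replaced by: draw $\tau^2$ from the density on $(0,\infty)$ proportional to $t\mapsto\exp\{-t\,\tilde\beta^\top\Lambda X^\top X\Lambda\tilde\beta/(2\sigma^2)+\sqrt t\,\tilde\beta^\top\Lambda X^\top y/\sigma^2\}\pi_\tau(t)$, using the current $\tilde\beta,\sigma^2$ and the new $\lambda$.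 *)

theory Defs
  imports "HOL-Analysis.Analysis" "HOL-Probability.Probability"
begin

definition ndens :: "'a measure \<Rightarrow> ('a \<Rightarrow> real) \<Rightarrow> 'a measure" where
  "ndens M f = density M (\<lambda>x. ennreal (f x) / (\<integral>\<^sup>+ z. ennreal (f z) \<partial>M))"

definition invgamma :: "real \<Rightarrow> real \<Rightarrow> real measure" where
  "invgamma \<alpha> \<beta> = ndens lborel
     (\<lambda>x. if 0 < x then x powr (-\<alpha> - 1) * exp (- \<beta> / x) else 0)"

definition mvnormal :: "real^'p \<Rightarrow> real^'p^'p \<Rightarrow> (real^'p) measure" where
  "mvnormal m S = ndens lborel
     (\<lambda>x. exp (- ((x - m) \<bullet> (matrix_inv S *v (x - m))) / 2))"

definition diagm :: "real^'p \<Rightarrow> real^'p^'p" where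
  "diagm v = (\<chi> i j. if i = j then v $ i else 0)"

definition hadamard :: "real^'p \<Rightarrow> real^'p \<Rightarrow> real^'p" where
  "hadamard u v = (\<chi> i. u $ i * v $ i)"

definition posdef :: "real^'p^'p \<Rightarrow> bool" where
  "posdef M \<longleftrightarrow> transpose M = M \<and> (\<forall>v. v \<noteq> 0 \<longrightarrow> 0 < v \<bullet> (M *v v))"

fun kiter :: "('a::topological_space \<Rightarrow> 'a measure) \<Rightarrow> nat \<Rightarrow> 'a \<Rightarrow> 'a measure" where
  "kiter K 0 x = return borel x"
| "kiter K (Suc n) x = kiter K n x \<bind> K"

definition tv_dist :: "'a measure \<Rightarrow> 'a measure \<Rightarrow> real" where
  "tv_dist M N = (SUP A\<in>sets M. \<bar>measure M A - measure N A\<bar>)"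

text \<open>Geometric ergodicity: there is a probability measure Pi (necessarily the unique
  stationary distribution), rho < 1 and a finite function Mf such that
  ||K^n(x,.) - Pi||_TV <= Mf x * rho^n for every state x in S and every n.\<close>
definition geom_ergodic :: "('a::topological_space \<Rightarrow> 'a measure) \<Rightarrow> 'a set \<Rightarrow> bool" where
  "geom_ergodic K S \<longleftrightarrow> (\<exists>Pim \<rho> Mf. prob_space Pim \<and> sets Pim = sets borel \<and> 0 \<le> \<rho> \<and> \<rho> < 1 \<and>
      (\<forall>x\<in>S. \<forall>n. tv_dist (kiter K n x) Pim \<le> Mf x * \<rho> ^ n))"

type_synonym 'p state = "(real^'p) \<times> (real^'p) \<times> real \<times> real \<times> (real^'p)"
  (* (theta, beta_tilde, sigma2, tau2, lambda) *)

definition XtX :: "real^'p^'n \<Rightarrow> real^'p^'p" where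
  "XtX X = transpose X ** X"

definition Amat :: "real^'p^'n \<Rightarrow> real \<Rightarrow> real^'p^'p" where
  "Amat X d = (1 / d) *\<^sub>R mat 1 + matrix_inv (matrix_inv (XtX X) - d *\<^sub>R mat 1)"

definition bvec :: "real^'n \<Rightarrow> real^'p^'n \<Rightarrow> real \<Rightarrow> real^'p" where
  "bvec y X d = matrix_inv (matrix_inv (XtX X) - d *\<^sub>R mat 1) *v
       (matrix_inv (XtX X) *v (transpose X *v y))"

definition Rfun :: "real^'n \<Rightarrow> real^'p^'n \<Rightarrow> real \<Rightarrow> real \<Rightarrow> real^'p \<Rightarrow> real" where
  "Rfun y X b' t l = (y \<bullet> y - y \<bullet> ((X ** diagm l **
        matrix_inv ((1 / t) *\<^sub>R mat 1 + diagm l ** XtX X ** diagm l) **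
        diagm l ** transpose X) *v y)) / 2 + b'"

text \<open>Step (a): joint density of the independent lambda_k draws (product of the
  one-dimensional unnormalised densities).\<close>
definition lam_dens :: "(real \<Rightarrow> real) \<Rightarrow> real \<Rightarrow> real^'p \<Rightarrow> real^'p \<Rightarrow> real \<Rightarrow> real \<Rightarrow> real^'p \<Rightarrow> real" where
  "lam_dens pl d \<theta> \<beta> s2 t2 l =
     (\<Prod>k\<in>UNIV. exp (- (sqrt t2 * l $ k * \<beta> $ k - \<theta> $ k)\<^sup>2 / (2 * d * s2)) * pl (l $ k))"

definition tau_dens2 :: "real^'n \<Rightarrow> real^'p^'n \<Rightarrow> real \<Rightarrow> real \<Rightarrow> (real \<Rightarrow> real) \<Rightarrow> real^'p \<Rightarrow> real \<Rightarrow> real" where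
  "tau_dens2 y X a' b' pt l t = (if 0 < t then
      pt t * det (mat 1 + t *\<^sub>R (diagm l ** XtX X ** diagm l)) powr (-1/2)
        * Rfun y X b' t l powr (- (real CARD('n) / 2 + a'))
    else 0)"

definition tau_dens3 :: "real^'n \<Rightarrow> real^'p^'n \<Rightarrow> (real \<Rightarrow> real) \<Rightarrow> real^'p \<Rightarrow> real \<Rightarrow> real^'p \<Rightarrow> real \<Rightarrow> real" where
  "tau_dens3 y X pt \<beta> s2 l t = (if 0 < t then
      exp (- t * (\<beta> \<bullet> ((diagm l ** XtX X ** diagm l) *v \<beta>)) / (2 * s2)
           + sqrt t * (\<beta> \<bullet> ((diagm l ** transpose X) *v y)) / s2) * pt t
    else 0)"

definition step_c :: "real^'n \<Rightarrow> real^'p^'n \<Rightarrow> real \<Rightarrow> real \<Rightarrow> real \<Rightarrow> real \<Rightarrow> real^'p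
    \<Rightarrow> ('n::finite) itself \<Rightarrow> 'p state measure" where
  "step_c y X a' b' d t2 l _ =
     invgamma (real CARD('n) / 2 + a') (Rfun y X b' t2 l) \<bind> (\<lambda>s2.
     mvnormal (sqrt t2 *\<^sub>R (matrix_inv (mat 1 + t2 *\<^sub>R (diagm l ** XtX X ** diagm l))
                 *v (diagm l *v (transpose X *v y))))
              (s2 *\<^sub>R matrix_inv (mat 1 + t2 *\<^sub>R (diagm l ** XtX X ** diagm l))) \<bind> (\<lambda>\<beta>.
     mvnormal (matrix_inv (Amat X d) *v ((sqrt t2 / d) *\<^sub>R hadamard l \<beta> + bvec y X d))
              (s2 *\<^sub>R matrix_inv (Amat X d)) \<bind> (\<lambda>\<theta>.
     return borel (\<theta>, \<beta>, s2, t2, l))))"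

definition alg2 :: "real^'n \<Rightarrow> real^'p^'n \<Rightarrow> real \<Rightarrow> real \<Rightarrow> real \<Rightarrow> (real \<Rightarrow> real) \<Rightarrow> (real \<Rightarrow> real)
    \<Rightarrow> 'p state \<Rightarrow> 'p state measure" where
  "alg2 y X a' b' d pt pl = (\<lambda>(\<theta>, \<beta>, s2, t2, l).
     ndens lborel (lam_dens pl d \<theta> \<beta> s2 t2) \<bind> (\<lambda>l'.
     ndens lborel (tau_dens2 y X a' b' pt l') \<bind> (\<lambda>t2'.
     step_c y X a' b' d t2' l' TYPE('n))))"

definition alg3 :: "real^'n \<Rightarrow> real^'p^'n \<Rightarrow> real \<Rightarrow> real \<Rightarrow> real \<Rightarrow> (real \<Rightarrow> real) \<Rightarrow> (real \<Rightarrow> real)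
    \<Rightarrow> 'p state \<Rightarrow> 'p state measure" where
  "alg3 y X a' b' d pt pl = (\<lambda>(\<theta>, \<beta>, s2, t2, l).
     ndens lborel (lam_dens pl d \<theta> \<beta> s2 t2) \<bind> (\<lambda>l'.
     ndens lborel (tau_dens3 y X pt \<beta> s2 l') \<bind> (\<lambda>t2'.
     step_c y X a' b' d t2' l' TYPE('n))))"

definition state_space :: "'p state set" where
  "state_space = {(\<theta>, \<beta>, s2, t2, l). 0 < s2 \<and> 0 < t2}"

end

theory Submission
  imports Defs
begin

text \<open>Both chains are in fact uniformly ergodic: a two-step Doeblin condition holds on the whole state
  space. Let \<open>C\<close> be the set of states with \<open>1 \<le> \<sigma>\<^sup>2\<close>, \<open>0 < \<tau>\<^sup>2 \<le> T\<close> and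
  \<open>\<bar>\<theta>\<bar>\<^sup>2, \<bar>\<beta>\<bar>\<^sup>2 \<le> N \<sigma>\<^sup>2\<close>. On \<open>C\<close> the density of
  the new \<open>\<lambda>\<close> dominates a fixed Gaussian tilt of its prior, and for Algorithm 3 the density of the new
  \<open>\<tau>\<^sup>2\<close> dominates a multiple of its prior, so \<open>C\<close> is a small set. From every state, \<open>C\<close> is
  entered with a probability bounded away from zero: \<open>R\<close> lies between two positive constants;
  whatever \<open>\<lambda>\<close> is, the mean \<open>m\<close> of \<open>\<beta>\<close> and its image \<open>\<tau> X \<Lambda> m\<close> have norm at most
  \<open>\<bar>y\<bar>\<close>; and the precision of \<open>\<beta>\<close> controls both \<open>\<beta>\<close> and
  \<open>\<tau> X \<Lambda> \<beta>\<close>, hence \<open>\<tau> \<Lambda> \<beta>\<close> and the mean of \<open>\<theta>\<close>.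
  For Algorithm 2 the determinant factor decreases in \<open>\<tau>\<^sup>2\<close>, which makes the law of \<open>\<tau>\<^sup>2\<close>
  tight uniformly in \<open>\<lambda>\<close>.\<close>

subsection \<open>Minorization and geometric ergodicity\<close>

text \<open>An extreme starting state can push the new \<open>\<lambda>\<close> anywhere, so the
  first step gets no lower bound on the law of \<open>\<lambda>\<close>: every estimate for entering
  the small set is made with \<open>\<lambda>\<close> fixed and with a constant free of it, and so
  survives averaging. A common component is extracted only in the second step. Sizes are measured
  against \<open>s\<close>, the current variance: the normal draws fluctuate on the scale
  \<open>sqrt s\<close>, and the exponents in the draws of \<open>\<lambda>\<close> and of the
  global scale are divided by \<open>s\<close>, so \<open>s\<close> cancels. The floor
  \<open>1 \<le> s\<close> lets fixed quantities such as \<open>norm y\<close> be absorbed into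
  multiples of \<open>sqrt s\<close>. No stationary law is given in advance. It is built as the
  setwise limit of the laws of the chain from one point; one contraction gives its existence, its
  sigma-additivity and the rate. Globally the kernels are only sub-probability kernels, because an
  unnormalizable \<open>ndens\<close> is a null measure; full mass is proved on the state space
  only.\<close>

context
  fixes K :: "'a::topological_space \<Rightarrow> 'a measure" and S :: "'a set"
  assumes K [measurable]: "K \<in> borel \<rightarrow>\<^sub>M subprob_algebra borel"
    and S [measurable]: "S \<in> sets borel"
    and absorbing: "\<And>x. x \<in> S \<Longrightarrow> emeasure (K x) S = 1"
begin

lemma measurable_kiter [measurable]: "kiter K n \<in> borel \<rightarrow>\<^sub>M subprob_algebra borel"
  by (induction n) (auto intro: return_measurable measurable_bind2[OF _ K])

lemma kiter_add: "kiter K (m + n) x = kiter K m x \<bind> kiter K n"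
proof (induction n)
  case 0
  have "sets (kiter K m x) = sets borel"
    using sets_kernel[OF measurable_kiter] by simp
  moreover have "kiter K 0 = return borel"
    by (simp add: fun_eq_iff)
  ultimately show ?case by (simp add: bind_return'')
next
  case (Suc n)
  have s: "sets (kiter K m x) = sets borel"
    using sets_kernel[OF measurable_kiter] by simp
  have "kiter K n \<in> kiter K m x \<rightarrow>\<^sub>M subprob_algebra borel"
    using measurable_kiter[of n] by (simp add: measurable_cong_sets[OF s refl])
  then show ?case using Suc by (simp add: bind_assoc[OF _ K])
qed

lemma sets_kiter [measurable_cong, simp]: "sets (kiter K n x) = sets borel"
  using sets_kernel[OF measurable_kiter] by simp

lemma space_kiter [simp]: "space (kiter K n x) = UNIV"
  using sets_eq_imp_space_eq[OF sets_kiter] by simp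

lemma subprob_kiter: "subprob_space (kiter K n x)"
  using subprob_space_kernel[OF measurable_kiter] by simp

text \<open>Mass one on \<open>S\<close> is reproduced by every step, although \<open>K\<close> may
  lose mass outside \<open>S\<close>. This is what turns sub-probabilities into probabilities for
  starting points in \<open>S\<close>.\<close>

lemma kiter_absorbing: "x \<in> S \<Longrightarrow> emeasure (kiter K n x) S = 1"
proof (induction n)
  case (Suc n)
  interpret subprob_space "kiter K n x" by (rule subprob_kiter)
  have "emeasure (kiter K (Suc n) x) S = (\<integral>\<^sup>+z. emeasure (K z) S \<partial>kiter K n x)"
    by (simp add: emeasure_bind[where N=borel])
  also have "\<dots> \<ge> (\<integral>\<^sup>+z. indicator S z \<partial>kiter K n x)"
    by (intro nn_integral_mono) (simp add: absorbing split: split_indicator)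
  finally have "1 \<le> emeasure (kiter K (Suc n) x) S"
    using Suc by simp
  then show ?case
    using subprob_space.subprob_emeasure_le_1[OF subprob_kiter, of "Suc n" x S]
    by (intro antisym) auto
qed (simp add: emeasure_return)

lemma prob_kiter: "x \<in> S \<Longrightarrow> prob_space (kiter K n x)"
proof (rule prob_spaceI)
  assume "x \<in> S"
  then have "1 \<le> emeasure (kiter K n x) (space (kiter K n x))"
    using kiter_absorbing[of x n] emeasure_mono[of S UNIV "kiter K n x"] by simp
  then show "emeasure (kiter K n x) (space (kiter K n x)) = 1"
    using subprob_space.subprob_emeasure_le_1[OF subprob_kiter] by (intro antisym) auto
qed

lemma AE_kiter: "x \<in> S \<Longrightarrow> AE z in kiter K n x. z \<in> S"
  using prob_space.AE_in_set_eq_1[OF prob_kiter, of x S n] kiter_absorbing[of x n]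
  by (simp add: measure_def)

lemma measurable_measure_kiter [measurable]:
  "A \<in> sets borel \<Longrightarrow> (\<lambda>z. measure (kiter K n z) A) \<in> borel_measurable borel"
  by (rule measurable_compose[OF measurable_kiter measurable_measure_subprob_algebra])

text \<open>Chapman-Kolmogorov with real values: a later law is an average of transition
  probabilities, the form in which oscillation bounds are applied.\<close>

lemma measure_kiter_add:
  assumes A [measurable]: "A \<in> sets borel" and x: "x \<in> S"
  shows "measure (kiter K (m + n) x) A = (\<integral>z. measure (kiter K n z) A \<partial>kiter K m x)"
proof -
  interpret P: prob_space "kiter K m x" by (rule prob_kiter[OF x])
  interpret P': prob_space "kiter K (m+n) x" by (rule prob_kiter[OF x])
  have fin: "emeasure (kiter K n z) A = ennreal (measure (kiter K n z) A)" for z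
    using subprob_kiter[of n z] by (simp add: finite_measure.emeasure_eq_measure subprob_space_def)
  have "ennreal (measure (kiter K (m + n) x) A) = emeasure (kiter K (m + n) x) A"
    by (simp add: P'.emeasure_eq_measure)
  also have "\<dots> = (\<integral>\<^sup>+z. emeasure (kiter K n z) A \<partial>kiter K m x)"
    unfolding kiter_add by (rule emeasure_bind[where N=borel]) auto
  also have "\<dots> = ennreal (\<integral>z. measure (kiter K n z) A \<partial>kiter K m x)"
    unfolding fin
    by (intro nn_integral_eq_integral P.integrable_const_bound[where B=1] AE_I2)
       (auto intro: subprob_space.subprob_measure_le_1 subprob_kiter)
  finally show ?thesis
    by (subst (asm) ennreal_inj) auto
qed

lemma integrable_measure_kiter:
  "A \<in> sets borel \<Longrightarrow> x \<in> S \<Longrightarrow> integrable (kiter K m x) (\<lambda>z. measure (kiter K n z) A)"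
  by (intro finite_measure.integrable_const_bound[where B=1] AE_I2)
     (auto intro: subprob_space.subprob_measure_le_1 subprob_kiter prob_space.finite_measure prob_kiter)

context
  fixes Q :: "'a measure" and x0 :: 'a
  assumes x0: "x0 \<in> S"
    and Q [measurable_cong]: "sets Q = sets borel"
    and minor: "\<And>x A. x \<in> S \<Longrightarrow> A \<in> sets borel \<Longrightarrow> emeasure Q A \<le> emeasure (kiter K 2 x) A"
    and Q_pos: "0 < emeasure Q UNIV"
begin

text \<open>\<open>Q\<close> is dominated by a law of the chain started in \<open>S\<close>, which
  lives on \<open>S\<close>. Test functions can therefore be left uncontrolled outside
  \<open>S\<close>. The mass of the unnormalized \<open>Q\<close> is the Doeblin constant.\<close>

lemma Q_S: "emeasure Q UNIV = emeasure Q S"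
proof -
  have "emeasure Q (UNIV - S) \<le> emeasure (kiter K 2 x0) (UNIV - S)"
    by (rule minor[OF x0]) auto
  also have "\<dots> = 0"
    using AE_kiter[OF x0, of 2]
    by (subst (asm) AE_iff_measurable[of "UNIV - S"]) auto
  finally have "emeasure Q (UNIV - S) = 0" by simp
  moreover have "emeasure Q UNIV = emeasure Q S + emeasure Q (UNIV - S)"
    by (subst plus_emeasure) (auto simp: Q)
  ultimately show ?thesis by simp
qed

lemma Q_le_1: "emeasure Q UNIV \<le> 1"
  using minor[OF x0, of UNIV] subprob_space.subprob_emeasure_le_1[OF subprob_kiter, of 2 x0 UNIV]
  by simp

text \<open>Apply the minorization to the nonnegative functions \<open>b - u\<close> under the law
  from \<open>x\<close> and \<open>u - a\<close> under the law from \<open>y\<close>. Their sum is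
  the constant \<open>b - a\<close> on \<open>S\<close>, so the two integrals add up to at least
  \<open>(b - a) * measure Q UNIV\<close>. This replaces a coupling argument.\<close>

lemma two_step_contraction:
  fixes u :: "'a \<Rightarrow> real"
  assumes u [measurable]: "u \<in> borel_measurable borel"
    and ab: "\<And>z. z \<in> S \<Longrightarrow> a \<le> u z" "\<And>z. z \<in> S \<Longrightarrow> u z \<le> b"
    and x: "x \<in> S" and y: "y \<in> S"
  shows "(\<integral>z. u z \<partial>kiter K 2 x) - (\<integral>z. u z \<partial>kiter K 2 y) \<le> (1 - measure Q UNIV) * (b - a)"
proof -
  interpret Px: prob_space "kiter K 2 x" by (rule prob_kiter[OF x])
  interpret Py: prob_space "kiter K 2 y" by (rule prob_kiter[OF y])
  have ab': "a \<le> b" using ab[OF x0] by simp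
  have AEx: "AE z in kiter K 2 x. a \<le> u z \<and> u z \<le> b"
    using AE_kiter[OF x] by eventually_elim (simp add: ab)
  have AEy: "AE z in kiter K 2 y. a \<le> u z \<and> u z \<le> b"
    using AE_kiter[OF y] by eventually_elim (simp add: ab)
  have ix: "integrable (kiter K 2 x) u"
  proof (rule Px.integrable_const_bound)
    show "AE z in kiter K 2 x. norm (u z) \<le> max \<bar>a\<bar> \<bar>b\<bar>"
      using AEx by eventually_elim auto
  qed simp
  have iy: "integrable (kiter K 2 y) u"
  proof (rule Py.integrable_const_bound)
    show "AE z in kiter K 2 y. norm (u z) \<le> max \<bar>a\<bar> \<bar>b\<bar>"
      using AEy by eventually_elim auto
  qed simp
  have le: "Q \<le> kiter K 2 z" if z: "z \<in> S" for z
  proof -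
    have "emeasure Q A \<le> emeasure (kiter K 2 z) A" for A
      using minor[OF z, of A] emeasure_notin_sets[of A Q] Q by (cases "A \<in> sets borel") auto
    then show ?thesis
      by (simp add: le_measure_iff Q sets_eq_imp_space_eq[OF Q] le_fun_def)
  qed
  have ex: "(\<integral>\<^sup>+z. ennreal (b - u z) \<partial>kiter K 2 x) = ennreal (b - (\<integral>z. u z \<partial>kiter K 2 x))"
  proof (subst nn_integral_eq_integral)
    show "AE z in kiter K 2 x. 0 \<le> b - u z" using AEx by eventually_elim simp
  qed (use ix Px.prob_space in auto)
  have ey: "(\<integral>\<^sup>+z. ennreal (u z - a) \<partial>kiter K 2 y) = ennreal ((\<integral>z. u z \<partial>kiter K 2 y) - a)"
  proof (subst nn_integral_eq_integral)
    show "AE z in kiter K 2 y. 0 \<le> u z - a" using AEy by eventually_elim simp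
  qed (use iy Py.prob_space in auto)
  have nx: "0 \<le> b - (\<integral>z. u z \<partial>kiter K 2 x)"
    using Px.integral_le_const[OF ix, of b] AEx by simp
  have ny: "0 \<le> (\<integral>z. u z \<partial>kiter K 2 y) - a"
    using Py.integral_ge_const[OF iy, of a] AEy by simp
  have fQ: "emeasure Q UNIV = ennreal (measure Q UNIV)"
    using Q_le_1 by (intro emeasure_eq_ennreal_measure) (auto simp: top_unique)
  have "ennreal ((b - a) * measure Q UNIV) = ennreal (b - a) * emeasure Q S"
    using ab' by (simp add: ennreal_mult fQ Q_S[symmetric])
  also have "\<dots> = (\<integral>\<^sup>+z. ennreal (b - a) * indicator S z \<partial>Q)"
    by (simp add: nn_integral_cmult_indicator)
  also have "\<dots> = (\<integral>\<^sup>+z. ennreal (b - u z) * indicator S z + ennreal (u z - a) * indicator S z \<partial>Q)"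
    using ab by (intro nn_integral_cong) (auto simp flip: ennreal_plus split: split_indicator)
  also have "\<dots> = (\<integral>\<^sup>+z. ennreal (b - u z) * indicator S z \<partial>Q) + (\<integral>\<^sup>+z. ennreal (u z - a) * indicator S z \<partial>Q)"
    by (intro nn_integral_add) auto
  also have "\<dots> \<le> (\<integral>\<^sup>+z. ennreal (b - u z) * indicator S z \<partial>kiter K 2 x) + (\<integral>\<^sup>+z. ennreal (u z - a) * indicator S z \<partial>kiter K 2 y)"
    by (intro add_mono nn_integral_mono_measure le x y) (auto simp: Q)
  also have "\<dots> \<le> (\<integral>\<^sup>+z. ennreal (b - u z) \<partial>kiter K 2 x) + (\<integral>\<^sup>+z. ennreal (u z - a) \<partial>kiter K 2 y)"
    by (intro add_mono nn_integral_mono) (auto split: split_indicator)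
  also have "\<dots> = ennreal ((b - (\<integral>z. u z \<partial>kiter K 2 x)) + ((\<integral>z. u z \<partial>kiter K 2 y) - a))"
    unfolding ex ey using nx ny by simp
  finally have "(b - a) * measure Q UNIV \<le> (b - (\<integral>z. u z \<partial>kiter K 2 x)) + ((\<integral>z. u z \<partial>kiter K 2 y) - a)"
    using nx ny by (subst (asm) ennreal_le_iff) auto
  then show ?thesis by (simp add: algebra_simps)
qed

lemma oscillation_even:
  assumes A [measurable]: "A \<in> sets borel"
  shows "x \<in> S \<Longrightarrow> y \<in> S \<Longrightarrow>
    measure (kiter K (2 * k) x) A - measure (kiter K (2 * k) y) A \<le> (1 - measure Q UNIV) ^ k"
proof (induction k arbitrary: x y)
  case 0
  then show ?case
    using subprob_space.subprob_measure_le_1[OF subprob_kiter, of 0 x A]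
      measure_nonneg[of "kiter K 0 y" A] unfolding mult_0_right power_0 by linarith
next
  case (Suc k)
  define u where "u z = measure (kiter K (2 * k) z) A" for z
  have u01: "0 \<le> u z" "u z \<le> 1" for z
    unfolding u_def by (auto intro: subprob_space.subprob_measure_le_1 subprob_kiter)
  define a b where "a = (INF z\<in>S. u z)" and "b = (SUP z\<in>S. u z)"
  have bb: "bdd_below (u ` S)" "bdd_above (u ` S)"
    using u01 by (auto intro!: bdd_belowI[of _ 0] bdd_aboveI[of _ 1])
  have ab: "a \<le> u z" "u z \<le> b" if "z \<in> S" for z
    unfolding a_def b_def using that bb by (auto intro: cINF_lower cSUP_upper)
  \<comment> \<open>The induction hypothesis compares any two points of \<open>S\<close>, so it
    bounds the supremum minus the infimum of \<open>u\<close>, which is what the contraction takes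
    as input.\<close>
  have "b \<le> (1 - measure Q UNIV) ^ k + u z" if z: "z \<in> S" for z
    unfolding b_def using Suc.IH[OF _ z] x0 by (intro cSUP_least) (auto simp: u_def algebra_simps)
  then have "b - (1 - measure Q UNIV) ^ k \<le> a"
    unfolding a_def using x0 by (intro cINF_greatest) (auto simp: algebra_simps)
  then have ba: "b - a \<le> (1 - measure Q UNIV) ^ k" by simp
  have q: "measure Q UNIV \<le> 1"
    using Q_le_1 by (simp add: measure_def enn2real_leI)
  have "measure (kiter K (2 * Suc k) z) A = (\<integral>w. u w \<partial>kiter K 2 z)" if "z \<in> S" for z
    using measure_kiter_add[OF A that, of 2 "2*k"] by (simp add: u_def)
  then have "measure (kiter K (2 * Suc k) x) A - measure (kiter K (2 * Suc k) y) A
     \<le> (1 - measure Q UNIV) * (b - a)"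
    using Suc.prems ab by (simp only:) (intro two_step_contraction, auto simp: u_def)
  also have "\<dots> \<le> (1 - measure Q UNIV) * (1 - measure Q UNIV) ^ k"
    using ba q by (intro mult_left_mono) auto
  finally show ?case by simp
qed

text \<open>Both quantities are averages over \<open>w\<close> of the same function
  \<open>measure (kiter K (2*k) w) A\<close>, whose oscillation on \<open>S\<close> is already
  bounded. Allowing different times \<open>m\<close> and \<open>n\<close> gives the Cauchy property
  in time and independence of the starting point at once.\<close>

lemma oscillation:
  assumes A [measurable]: "A \<in> sets borel" and x: "x \<in> S" and y: "y \<in> S"
    and m: "2 * k \<le> m" and n: "2 * k \<le> n"
  shows "measure (kiter K m x) A - measure (kiter K n y) A \<le> (1 - measure Q UNIV) ^ k"
proof -
  have up: "measure (kiter K m x) A \<le> (1 - measure Q UNIV) ^ k + measure (kiter K (2*k) z) A"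
    if z: "z \<in> S" for z
  proof -
    interpret P: prob_space "kiter K (m - 2*k) x" by (rule prob_kiter[OF x])
    have "measure (kiter K m x) A = (\<integral>w. measure (kiter K (2*k) w) A \<partial>kiter K (m - 2*k) x)"
      using measure_kiter_add[OF A x, of "m - 2*k" "2*k"] m by simp
    also have "\<dots> \<le> (1 - measure Q UNIV) ^ k + measure (kiter K (2*k) z) A"
    proof (intro P.integral_le_const integrable_measure_kiter A x)
      show "AE w in kiter K (m - 2*k) x. measure (kiter K (2*k) w) A
          \<le> (1 - measure Q UNIV) ^ k + measure (kiter K (2*k) z) A"
        using AE_kiter[OF x] by eventually_elim (use oscillation_even[OF A _ z, of _ k] in force)
    qed
    finally show ?thesis .
  qed
  interpret P: prob_space "kiter K (n - 2*k) y" by (rule prob_kiter[OF y])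
  have "measure (kiter K m x) A - (1 - measure Q UNIV) ^ k
      \<le> (\<integral>w. measure (kiter K (2*k) w) A \<partial>kiter K (n - 2*k) y)"
  proof (intro P.integral_ge_const integrable_measure_kiter A y)
    show "AE w in kiter K (n - 2*k) y. measure (kiter K m x) A - (1 - measure Q UNIV) ^ k
        \<le> measure (kiter K (2*k) w) A"
      using AE_kiter[OF y] by eventually_elim (use up in force)
  qed
  also have "\<dots> = measure (kiter K n y) A"
    using measure_kiter_add[OF A y, of "n - 2*k" "2*k"] n by simp
  finally show ?thesis by simp
qed

lemma oscillation_abs:
  assumes "A \<in> sets borel" "x \<in> S" "y \<in> S" "2 * k \<le> m" "2 * k \<le> n"
  shows "\<bar>measure (kiter K m x) A - measure (kiter K n y) A\<bar> \<le> (1 - measure Q UNIV) ^ k"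
  using oscillation[OF assms(1-5)] oscillation[OF assms(1,3,2,5,4)] by (auto simp: abs_le_iff)

lemma measure_Q: "0 < measure Q UNIV" "measure Q UNIV \<le> 1"
proof -
  have "emeasure Q UNIV = ennreal (measure Q UNIV)"
    using Q_le_1 by (intro emeasure_eq_ennreal_measure) (auto simp: top_unique)
  then show "0 < measure Q UNIV" "measure Q UNIV \<le> 1"
    using Q_pos Q_le_1 by auto
qed

text \<open>The candidate for the stationary probability of \<open>A\<close>. The starting point
  \<open>x0\<close> is immaterial for points of \<open>S\<close>, by
  \<open>oscillation_abs\<close>.\<close>

definition lim_mass :: "'a set \<Rightarrow> real" where
  "lim_mass A = lim (\<lambda>n. measure (kiter K n x0) A)"

lemma rate_null: "e > 0 \<Longrightarrow> \<exists>k. (1 - measure Q UNIV) ^ k < e"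
  using measure_Q by (intro real_arch_pow_inv) auto

lemma lim_mass_LIMSEQ:
  assumes A: "A \<in> sets borel"
  shows "(\<lambda>n. measure (kiter K n x0) A) \<longlonglongrightarrow> lim_mass A"
proof -
  have "Cauchy (\<lambda>n. measure (kiter K n x0) A)"
  proof (rule metric_CauchyI)
    fix e :: real assume "e > 0"
    then obtain k where "(1 - measure Q UNIV) ^ k < e" using rate_null by blast
    then show "\<exists>M. \<forall>m\<ge>M. \<forall>n\<ge>M. dist (measure (kiter K m x0) A) (measure (kiter K n x0) A) < e"
      using oscillation_abs[OF A x0 x0, of k]
      by (intro exI[of _ "2*k"]) (auto simp: dist_real_def intro: le_less_trans)
  qed
  then show ?thesis
    unfolding lim_mass_def by (simp add: Cauchy_convergent convergent_LIMSEQ_iff[symmetric])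
qed

lemma lim_mass_bound:
  assumes A: "A \<in> sets borel" and x: "x \<in> S" and k: "2 * k \<le> n"
  shows "\<bar>measure (kiter K n x) A - lim_mass A\<bar> \<le> (1 - measure Q UNIV) ^ k"
  using k by (intro LIMSEQ_le_const2[OF tendsto_rabs[OF tendsto_diff[OF tendsto_const lim_mass_LIMSEQ[OF A]]]]
      exI[of _ "2*k"] allI impI oscillation_abs A x x0)

definition limit_measure :: "'a measure" where
  "limit_measure = measure_of UNIV (sets borel) (\<lambda>A. ennreal (lim_mass A))"

lemma sets_limit_measure [simp]: "sets limit_measure = sets borel"
  unfolding limit_measure_def using sets.sigma_sets_eq[of "borel :: 'a measure"] by simp

lemma lim_mass_nonneg: "A \<in> sets borel \<Longrightarrow> 0 \<le> lim_mass A"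
  by (rule LIMSEQ_le_const[OF lim_mass_LIMSEQ]) auto

text \<open>Finite additivity passes to the limit. Countable additivity follows because the
  convergence is uniform in the set: along a sequence decreasing to the empty set, half of
  \<open>r\<close> pays for replacing the limit by the law at one fixed time \<open>2*k\<close>, and
  the other half for continuity from above of that single measure.\<close>

lemma emeasure_limit_measure:
  assumes A: "A \<in> sets borel"
  shows "emeasure limit_measure A = ennreal (lim_mass A)"
proof -
  let ?f = "\<lambda>A. ennreal (lim_mass A)"
  have emp: "lim_mass {} = 0" unfolding lim_mass_def by simp
  have pos: "positive (sets (borel :: 'a measure)) ?f"
    by (simp add: positive_def emp)
  have add: "additive (sets (borel :: 'a measure)) ?f"
    unfolding additive_def
  proof (intro ballI impI)
    fix A B :: "'a set" assume AB: "A \<in> sets borel" "B \<in> sets borel" "A \<inter> B = {}"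
    have "(\<lambda>n. measure (kiter K n x0) A + measure (kiter K n x0) B) \<longlonglongrightarrow> lim_mass A + lim_mass B"
      using AB by (intro tendsto_add lim_mass_LIMSEQ)
    moreover have "measure (kiter K n x0) A + measure (kiter K n x0) B = measure (kiter K n x0) (A \<union> B)" for n
      using AB prob_space.finite_measure[OF prob_kiter[OF x0, of n]]
      by (subst finite_measure.finite_measure_Union) auto
    ultimately have "(\<lambda>n. measure (kiter K n x0) (A \<union> B)) \<longlonglongrightarrow> lim_mass A + lim_mass B" by simp
    moreover have "(\<lambda>n. measure (kiter K n x0) (A \<union> B)) \<longlonglongrightarrow> lim_mass (A \<union> B)"
      using AB by (intro lim_mass_LIMSEQ) auto
    ultimately have "lim_mass (A \<union> B) = lim_mass A + lim_mass B"
      using LIMSEQ_unique by blast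
    then show "?f (A \<union> B) = ?f A + ?f B"
      using AB by (simp add: lim_mass_nonneg)
  qed
  interpret B: sigma_algebra UNIV "sets (borel :: 'a measure)"
    using sets.sigma_algebra_axioms[of "borel :: 'a measure"] by simp
  have "countably_additive (sets (borel :: 'a measure)) ?f"
  proof (rule B.empty_continuous_imp_countably_additive[OF pos add])
    fix A :: "nat \<Rightarrow> 'a set"
    assume A: "range A \<subseteq> sets borel" "decseq A" "(\<Inter>i. A i) = {}"
    have "(\<lambda>i. lim_mass (A i)) \<longlonglongrightarrow> 0"
    proof (rule LIMSEQ_I)
      fix r :: real assume "r > 0"
      then obtain k where k: "(1 - measure Q UNIV) ^ k < r / 2" using rate_null[of "r/2"] by auto
      interpret P: prob_space "kiter K (2*k) x0" by (rule prob_kiter[OF x0])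
      have "(\<lambda>i. measure (kiter K (2*k) x0) (A i)) \<longlonglongrightarrow> measure (kiter K (2*k) x0) (\<Inter>i. A i)"
        using A by (intro P.finite_Lim_measure_decseq) auto
      then have "(\<lambda>i. measure (kiter K (2*k) x0) (A i)) \<longlonglongrightarrow> 0" by (simp add: A)
      from LIMSEQ_D[OF this, of "r/2"] \<open>r > 0\<close>
      obtain N where N: "\<And>i. i \<ge> N \<Longrightarrow> measure (kiter K (2*k) x0) (A i) < r / 2" by auto
      show "\<exists>no. \<forall>n\<ge>no. norm (lim_mass (A n) - 0) < r"
      proof (intro exI allI impI)
        fix i assume "N \<le> i"
        have Ai: "A i \<in> sets borel" using A by auto
        show "norm (lim_mass (A i) - 0) < r"
          using lim_mass_bound[OF Ai x0, of k "2*k"] N[OF \<open>N \<le> i\<close>] k lim_mass_nonneg[OF Ai]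
          by (simp add: abs_le_iff)
      qed
    qed
    then show "(\<lambda>i. ?f (A i)) \<longlonglongrightarrow> 0"
      using tendsto_ennrealI by fastforce
  qed auto
  then show ?thesis
    unfolding limit_measure_def using pos A
    by (subst emeasure_measure_of_sigma) (auto intro: B.sigma_algebra_axioms)
qed

lemma prob_limit_measure: "prob_space limit_measure"
proof (rule prob_spaceI)
  have sp: "space limit_measure = UNIV"
    using sets_eq_imp_space_eq[OF sets_limit_measure] by simp
  have "measure (kiter K n x0) UNIV = 1" for n
    using prob_space.prob_space[OF prob_kiter[OF x0, of n]] by simp
  then have "lim_mass UNIV = 1" unfolding lim_mass_def by simp
  then show "emeasure limit_measure (space limit_measure) = 1"
    by (simp add: sp emeasure_limit_measure)
qed

theorem geom_ergodic_two_step_minorization: "geom_ergodic K S"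
proof -
  \<comment> \<open>The cap \<open>1/2\<close> keeps \<open>r\<close> positive even if
    \<open>Q\<close> has mass one, so that \<open>1 / r\<close> makes sense. The square root turns a
    contraction per two steps into a rate per step.\<close>
  define q where "q = min (1/2) (measure Q UNIV)"
  define r where "r = sqrt (1 - q)"
  have q: "0 < q" "q \<le> 1/2" "q \<le> measure Q UNIV" using measure_Q by (auto simp: q_def)
  have r: "0 < r" "r < 1" "r ^ 2 = 1 - q" using q by (auto simp: r_def)
  have "tv_dist (kiter K n x) limit_measure \<le> (1 / r) * r ^ n" if x: "x \<in> S" for x n
  proof -
    have "(1 - measure Q UNIV) ^ (n div 2) \<le> (1 - q) ^ (n div 2)"
      using q measure_Q by (intro power_mono) auto
    also have "\<dots> = r ^ (2 * (n div 2))" by (simp add: power_mult r)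
    \<comment> \<open>For odd \<open>n\<close> one step is lost in \<open>2 * (n div 2)\<close>; the
      factor \<open>1 / r\<close> in the final bound pays for it.\<close>
    also have "\<dots> \<le> r ^ (n - 1)"
      using r by (intro power_decreasing) auto
    also have "\<dots> \<le> (1 / r) * r ^ n"
      using r by (cases n) (auto simp: field_simps)
    finally have rate: "(1 - measure Q UNIV) ^ (n div 2) \<le> (1 / r) * r ^ n" .
    show ?thesis
      unfolding tv_dist_def
    proof (rule cSUP_least)
      fix A assume "A \<in> sets (kiter K n x)"
      then have A: "A \<in> sets borel" by simp
      have "measure limit_measure A = lim_mass A"
        using emeasure_limit_measure[OF A] lim_mass_nonneg[OF A] by (simp add: measure_def)
      then show "\<bar>measure (kiter K n x) A - measure limit_measure A\<bar> \<le> (1 / r) * r ^ n"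
        using lim_mass_bound[OF A x, of "n div 2" n] rate by simp
    qed auto
  qed
  then show ?thesis
    unfolding geom_ergodic_def using r prob_limit_measure
    by (intro exI[of _ limit_measure] exI[of _ r] exI[of _ "\<lambda>_. 1 / r"]) auto
qed

end

end

text \<open>The first step enters \<open>C\<close> with probability at least \<open>p\<close>, the
  second step from \<open>C\<close> dominates \<open>Q\<close>; hence two steps dominate
  \<open>p\<close> times \<open>Q\<close> from every point of \<open>S\<close>.\<close>

lemma geom_ergodic_small_set:
  fixes K :: "'a::topological_space \<Rightarrow> 'a measure" and Q :: "'a measure" and p :: ennreal
  assumes K [measurable]: "K \<in> borel \<rightarrow>\<^sub>M subprob_algebra borel"
    and S: "S \<in> sets borel" "x0 \<in> S" "\<And>x. x \<in> S \<Longrightarrow> emeasure (K x) S = 1"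
    and C [measurable]: "C \<in> sets borel" and p: "0 < p" "\<And>x. x \<in> S \<Longrightarrow> p \<le> emeasure (K x) C"
    and Q: "sets Q = sets borel" "0 < emeasure Q UNIV"
    and minor: "\<And>x A. x \<in> C \<Longrightarrow> A \<in> sets borel \<Longrightarrow> emeasure Q A \<le> emeasure (K x) A"
  shows "geom_ergodic K S"
proof (rule geom_ergodic_two_step_minorization[OF K S(1,3,2), where Q="scale_measure p Q"])
  have 2: "kiter K 2 x = K x \<bind> K" for x
    by (simp add: numeral_2_eq_2 bind_return[where N=borel])
  fix x A assume x: "x \<in> S" and A [measurable]: "A \<in> sets (borel :: 'a measure)"
  have [measurable_cong]: "sets (K x) = sets borel"
    using sets_kernel[OF K, of x] by simp
  then have sp: "space (K x) = UNIV"
    using sets_eq_imp_space_eq by fastforce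
  have "p * emeasure Q A \<le> emeasure (K x) C * emeasure Q A"
    using p(2)[OF x] by (rule mult_right_mono) simp
  also have "\<dots> = (\<integral>\<^sup>+z. emeasure Q A * indicator C z \<partial>K x)"
    by (subst nn_integral_cmult_indicator) (simp_all add: mult.commute)
  also have "\<dots> \<le> (\<integral>\<^sup>+z. emeasure (K z) A \<partial>K x)"
    by (intro nn_integral_mono) (auto simp: minor split: split_indicator)
  also have "\<dots> = emeasure (kiter K 2 x) A"
    unfolding 2 using sp by (subst emeasure_bind[where N=borel]) auto
  finally show "emeasure (scale_measure p Q) A \<le> emeasure (kiter K 2 x) A"
    by (simp add: emeasure_scale_measure)
qed (use p Q in \<open>auto simp: ennreal_zero_less_mult_iff\<close>)

text \<open>The device that carries lower bounds through a chain of draws: reach \<open>B\<close>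
  with probability at least \<open>a\<close>, then \<open>A\<close> with probability at least
  \<open>c\<close>. Keeping \<open>M'\<close> apart from \<open>M\<close> lets measurability of
  \<open>k\<close> be checked once over the Borel sets.\<close>

lemma emeasure_bind_ge:
  assumes k: "k \<in> M' \<rightarrow>\<^sub>M subprob_algebra N" and M: "sets M = sets M'"
    and B: "B \<in> sets M'" and A: "A \<in> sets N"
    and a: "a \<le> emeasure M B" and c: "\<And>x. x \<in> B \<Longrightarrow> c \<le> emeasure (k x) A"
  shows "a * c \<le> emeasure (M \<bind> k) A"
proof (cases "space M = {}")
  case True
  then have "B = {}" using sets.sets_into_space[OF B] sets_eq_imp_space_eq[OF M] by auto
  then show ?thesis using a by simp
next
  case False
  have [measurable]: "B \<in> sets M" using B M by simp
  have k': "k \<in> M \<rightarrow>\<^sub>M subprob_algebra N"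
    using k by (simp add: measurable_cong_sets[OF M refl])
  have "a * c \<le> emeasure M B * c" using a by (rule mult_right_mono) simp
  also have "\<dots> = (\<integral>\<^sup>+x. c * indicator B x \<partial>M)"
    by (subst nn_integral_cmult_indicator) (simp_all add: mult.commute)
  also have "\<dots> \<le> (\<integral>\<^sup>+x. emeasure (k x) A \<partial>M)"
    by (intro nn_integral_mono) (auto simp: c split: split_indicator)
  also have "\<dots> = emeasure (M \<bind> k) A"
    by (rule emeasure_bind[OF False k' A, symmetric])
  finally show ?thesis .
qed

section \<open>Normalized densities\<close>

lemma divide_left_mono_ennreal:
  fixes a b c :: ennreal
  assumes "a \<le> b" shows "c / b \<le> c / a"
proof -
  have "inverse b \<le> inverse a"
    using assms including ennreal.lifting by transfer (rule ereal_inverse_antimono)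
  then show ?thesis unfolding divide_ennreal_def by (rule mult_left_mono) simp
qed

lemma sets_ndens [simp, measurable_cong]: "sets (ndens M f) = sets M"
  by (simp add: ndens_def)

lemma space_ndens [simp]: "space (ndens M f) = space M"
  by (simp add: ndens_def)

lemma emeasure_ndens:
  assumes [measurable]: "f \<in> borel_measurable M" "A \<in> sets M"
  shows "emeasure (ndens M f) A = (\<integral>\<^sup>+z. ennreal (f z) * indicator A z \<partial>M) / (\<integral>\<^sup>+z. ennreal (f z) \<partial>M)"
proof -
  have "emeasure (ndens M f) A = (\<integral>\<^sup>+z. (ennreal (f z) * indicator A z) / (\<integral>\<^sup>+z. ennreal (f z) \<partial>M) \<partial>M)"
    unfolding ndens_def by (simp add: emeasure_density ennreal_times_divide mult.commute)
  then show ?thesis by (simp add: nn_integral_divide)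
qed

text \<open>No condition on the normalizer is imposed: the total mass is the normalizer divided by
  itself, and in \<open>ennreal\<close> this quotient is 0 when the normalizer is 0 or infinite, and
  1 otherwise.\<close>

lemma subprob_ndens:
  assumes "f \<in> borel_measurable M" "space M \<noteq> {}"
  shows "subprob_space (ndens M f)"
proof (rule subprob_spaceI)
  let ?Z = "\<integral>\<^sup>+z. ennreal (f z) \<partial>M"
  have "emeasure (ndens M f) (space M) = ?Z / ?Z"
    using assms by (subst emeasure_ndens) (auto cong: nn_integral_cong)
  also have "\<dots> \<le> 1"
    by (cases "?Z = 0 \<or> ?Z = \<infinity>") (auto simp: ennreal_divide_self less_top)
  finally show "emeasure (ndens M f) (space (ndens M f)) \<le> 1" by simp
qed (use assms in simp)

lemma prob_ndens:
  assumes "f \<in> borel_measurable M" "(\<integral>\<^sup>+z. ennreal (f z) \<partial>M) \<noteq> 0" "(\<integral>\<^sup>+z. ennreal (f z) \<partial>M) < \<infinity>"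
  shows "prob_space (ndens M f)"
proof (rule prob_spaceI)
  let ?Z = "\<integral>\<^sup>+z. ennreal (f z) \<partial>M"
  have "emeasure (ndens M f) (space M) = ?Z / ?Z"
    using assms by (subst emeasure_ndens) (auto cong: nn_integral_cong)
  also have "\<dots> = 1"
    using assms by (simp add: ennreal_divide_self)
  finally show "emeasure (ndens M f) (space (ndens M f)) = 1" by simp
qed

lemma measurable_ndens:
  fixes f :: "'a \<Rightarrow> 'b::euclidean_space \<Rightarrow> real"
  assumes [measurable]: "(\<lambda>(x, z). f x z) \<in> borel_measurable (N \<Otimes>\<^sub>M borel)"
  shows "(\<lambda>x. ndens lborel (f x)) \<in> N \<rightarrow>\<^sub>M subprob_algebra borel"
proof (rule measurable_subprob_algebra)
  fix a assume [measurable]: "a \<in> space N"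
  show "subprob_space (ndens lborel (f a))"
    by (rule subprob_ndens) auto
next
  fix A :: "'b set" assume [measurable]: "A \<in> sets borel"
  have "(\<lambda>a. (\<integral>\<^sup>+z. ennreal (f a z) * indicator A z \<partial>lborel) / (\<integral>\<^sup>+z. ennreal (f a z) \<partial>lborel)) \<in> borel_measurable N"
    by measurable
  then show "(\<lambda>a. emeasure (ndens lborel (f a)) A) \<in> borel_measurable N"
    by (rule measurable_cong[THEN iffD1, rotated]) (auto intro!: emeasure_ndens[symmetric])
qed simp

subsection \<open>Inverse gamma and normal distributions\<close>

definition ig_weight :: "real \<Rightarrow> real \<Rightarrow> real \<Rightarrow> real" where
  "ig_weight \<alpha> \<beta> x = (if 0 < x then x powr (-\<alpha> - 1) * exp (- \<beta> / x) else 0)"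

lemma ig_weight_measurable [measurable]: "ig_weight \<alpha> \<beta> \<in> borel_measurable borel"
  unfolding ig_weight_def by measurable

lemma ig_weight_antimono: "\<beta> \<le> \<beta>' \<Longrightarrow> ig_weight \<alpha> \<beta>' x \<le> ig_weight \<alpha> \<beta> x"
  by (auto simp: ig_weight_def divide_right_mono intro!: mult_left_mono)

text \<open>The bound is the maximum of the weight, attained at
  \<open>x = \<beta> / (\<alpha> + 1)\<close>. It comes from \<open>ln z \<le> z - 1\<close> with
  \<open>z = \<beta> / ((\<alpha> + 1) * x)\<close>.\<close>

lemma ig_weight_bounded:
  assumes "0 < \<alpha>" "0 < \<beta>"
  shows "ig_weight \<alpha> \<beta> x \<le> exp (- (\<alpha> + 1) * (1 + ln (\<beta> / (\<alpha> + 1))))"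
proof (cases "0 < x")
  case True
  let ?c = "\<beta> / (\<alpha> + 1)"
  have "ln (?c * (1 / x)) \<le> ?c * (1 / x) - 1"
    using assms True by (intro ln_le_minus_one) auto
  then have "(\<alpha> + 1) * (ln ?c - ln x) \<le> (\<alpha> + 1) * (?c * (1 / x) - 1)"
    using assms True by (intro mult_left_mono) (auto simp: ln_div ln_mult)
  also have "\<dots> = \<beta> / x - (\<alpha> + 1)"
    using assms unfolding right_diff_distrib by simp
  finally have "(- \<alpha> - 1) * ln x - \<beta> / x \<le> - (\<alpha> + 1) * (1 + ln ?c)"
    by (simp add: algebra_simps)
  then show ?thesis
    using True by (simp add: ig_weight_def powr_def flip: exp_add)
qed (simp add: ig_weight_def)

text \<open>On \<open>{0..1}\<close> the exponential tames the pole and the weight is bounded;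
  beyond 1 the power \<open>x powr (- \<alpha> - 1)\<close> is integrable.\<close>

lemma ig_weight_finite:
  assumes a: "0 < \<alpha>" and b: "0 < \<beta>"
  shows "(\<integral>\<^sup>+x. ennreal (ig_weight \<alpha> \<beta> x) \<partial>lborel) < \<infinity>"
proof -
  let ?B = "exp (- (\<alpha> + 1) * (1 + ln (\<beta> / (\<alpha> + 1))))"
  have tail: "(\<integral>\<^sup>+x. ennreal (x powr (- \<alpha> - 1)) * indicator {1..} x \<partial>lborel) = ennreal (0 - (- (1 powr (- \<alpha>) / \<alpha>)))"
  proof (rule nn_integral_FTC_atLeast)
    show "((\<lambda>x. - (x powr (- \<alpha>) / \<alpha>)) \<longlongrightarrow> 0) at_top"
      using tendsto_minus[OF tendsto_divide[OF tendsto_neg_powr[OF _ filterlim_ident, of "- \<alpha>"] tendsto_const[of \<alpha>]]] a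
      by simp
    fix x :: real assume "1 \<le> x"
    then show "((\<lambda>x. - (x powr (- \<alpha>) / \<alpha>)) has_real_derivative x powr (- \<alpha> - 1)) (at x)"
      using a by (auto intro!: derivative_eq_intros simp: powr_diff field_simps)
  qed auto
  have "(\<integral>\<^sup>+x. ennreal (ig_weight \<alpha> \<beta> x) \<partial>lborel)
    \<le> (\<integral>\<^sup>+x. ennreal ?B * indicator {0..1} x + ennreal (x powr (- \<alpha> - 1)) * indicator {1..} x \<partial>lborel)"
  proof (rule nn_integral_mono)
    fix x :: real
    consider "x \<le> 0" | "0 < x" "x \<le> 1" | "1 < x" by linarith
    then show "ennreal (ig_weight \<alpha> \<beta> x) \<le> ennreal ?B * indicator {0..1} x + ennreal (x powr (- \<alpha> - 1)) * indicator {1..} x"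
    proof cases
      case 2
      then have "ennreal (ig_weight \<alpha> \<beta> x) \<le> ennreal ?B * indicator {0..1} x"
        using ig_weight_bounded[OF a b, of x] by (simp del: ennreal_le_iff add: ennreal_leI)
      then show ?thesis by (rule order_trans) simp
    next
      case 3
      then have "x powr (- \<alpha> - 1) * exp (- \<beta> / x) \<le> x powr (- \<alpha> - 1) * 1"
        using b by (intro mult_left_mono) auto
      with 3 show ?thesis by (simp add: ig_weight_def ennreal_leI)
    qed (simp add: ig_weight_def)
  qed
  also have "\<dots> = (\<integral>\<^sup>+x. ennreal ?B * indicator {0..1::real} x \<partial>lborel) + ennreal (0 - (- (1 powr (- \<alpha>) / \<alpha>)))"
    by (subst nn_integral_add) (auto simp: tail)
  also have "\<dots> < \<infinity>"
    by (subst nn_integral_cmult_indicator) (auto simp: ennreal_mult_less_top)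
  finally show ?thesis .
qed

lemma ig_weight_pos_tail:
  "0 < (\<integral>\<^sup>+x. ennreal (ig_weight \<alpha> \<beta> x) * indicator {1..} x \<partial>lborel)"
proof (rule ccontr)
  assume "\<not> ?thesis"
  then have "(\<integral>\<^sup>+x. ennreal (ig_weight \<alpha> \<beta> x) * indicator {1..} x \<partial>lborel) = 0" by simp
  then have "AE x in lborel. ennreal (ig_weight \<alpha> \<beta> x) * indicator {1..} x = 0"
    by (subst (asm) nn_integral_0_iff_AE) auto
  then have "AE x in lborel. x \<notin> {1::real..2}"
    by eventually_elim (auto simp: ig_weight_def split: if_splits)
  then have "emeasure lborel {1::real..2} = 0"
    by (subst (asm) AE_iff_measurable[where N="{1..2}"]) auto
  then show False by simp
qed

lemma invgamma_eq: "invgamma \<alpha> \<beta> = ndens lborel (ig_weight \<alpha> \<beta>)"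
  unfolding invgamma_def ig_weight_def[abs_def] ..

lemma ig_weight_pos:
  "0 < (\<integral>\<^sup>+x. ennreal (ig_weight \<alpha> \<beta> x) \<partial>lborel)"
  by (rule less_le_trans[OF ig_weight_pos_tail[of \<alpha> \<beta>]]) (auto intro!: nn_integral_mono split: split_indicator)

lemma prob_invgamma: "0 < \<alpha> \<Longrightarrow> 0 < \<beta> \<Longrightarrow> prob_space (invgamma \<alpha> \<beta>)"
  unfolding invgamma_eq
  by (rule prob_ndens[OF _ _ ig_weight_finite]) (use ig_weight_pos[of \<alpha> \<beta>] in auto)

lemma invgamma_positive:
  assumes "0 < \<alpha>" "0 < \<beta>" shows "emeasure (invgamma \<alpha> \<beta>) {0<..} = 1"
proof -
  have "emeasure (invgamma \<alpha> \<beta>) {0<..} = emeasure (invgamma \<alpha> \<beta>) (space (invgamma \<alpha> \<beta>))"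
    unfolding invgamma_eq space_ndens
    by (subst (1 2) emeasure_ndens)
       (auto intro!: arg_cong2[where f="(/)"] nn_integral_cong simp: ig_weight_def split: split_indicator)
  then show ?thesis using prob_space.emeasure_space_1[OF prob_invgamma[OF assms]] by simp
qed

text \<open>The weight decreases in its scale parameter, so the numerator is smallest at
  \<open>b'\<close> and the normalizer largest at \<open>b\<close>. The quotient of these two
  extremes serves for all scales between them.\<close>

lemma invgamma_atLeast_1:
  assumes "0 < \<alpha>" "0 < b"
  obtains p :: real where "0 < p" "\<And>\<beta>. b \<le> \<beta> \<Longrightarrow> \<beta> \<le> b' \<Longrightarrow> ennreal p \<le> emeasure (invgamma \<alpha> \<beta>) {1..}"
proof -
  let ?Y = "\<integral>\<^sup>+x. ennreal (ig_weight \<alpha> b' x) * indicator {1..} x \<partial>lborel"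
  let ?Z = "\<integral>\<^sup>+x. ennreal (ig_weight \<alpha> b x) \<partial>lborel"
  have Z: "?Z < \<infinity>" by (rule ig_weight_finite[OF assms])
  \<comment> \<open>Capping at 1 makes the quotient finite, so that a positive real constant can be
    read off.\<close>
  define p where "p = enn2real (min 1 (?Y / ?Z))"
  have p_eq: "ennreal p = min 1 (?Y / ?Z)"
    unfolding p_def by (rule ennreal_enn2real) (simp add: min_less_iff_disj)
  have "0 < ?Y / ?Z"
    using ig_weight_pos_tail[of \<alpha> b'] Z unfolding ennreal_zero_less_divide by simp
  then have "0 < ennreal p" unfolding p_eq by (simp only: min_less_iff_conj) simp
  then have p: "0 < p" by (simp only: ennreal_less_zero_iff)
  show thesis
  proof (rule that[OF p])
    fix \<beta> assume \<beta>: "b \<le> \<beta>" "\<beta> \<le> b'"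
    have "ennreal p \<le> ?Y / ?Z" unfolding p_eq by (rule min.cobounded2)
    also have "\<dots> \<le> (\<integral>\<^sup>+x. ennreal (ig_weight \<alpha> \<beta> x) * indicator {1..} x \<partial>lborel) / (\<integral>\<^sup>+x. ennreal (ig_weight \<alpha> \<beta> x) \<partial>lborel)"
      by (intro order_trans[OF divide_right_mono_ennreal divide_left_mono_ennreal] nn_integral_mono
          mult_right_mono ennreal_leI ig_weight_antimono \<beta>) auto
    also have "\<dots> = emeasure (invgamma \<alpha> \<beta>) {1..}"
      unfolding invgamma_eq by (subst emeasure_ndens) auto
    finally show "ennreal p \<le> emeasure (invgamma \<alpha> \<beta>) {1..}" .
  qed
qed

text \<open>A lower bound on the quadratic form only. It is stable under positive scaling and under
  adding nonnegative forms, and for positive \<open>c\<close> it yields both invertibility and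
  integrability of the Gaussian weight, which is how precision matrices are treated below.\<close>

definition coercive :: "real \<Rightarrow> real^'p^'p \<Rightarrow> bool" where
  "coercive c M \<longleftrightarrow> (\<forall>v. c * (v \<bullet> v) \<le> v \<bullet> (M *v v))"

lemma quad_form_measurable [measurable]:
  "(\<lambda>x. (x - m) \<bullet> ((M :: real^'p^'p) *v (x - m))) \<in> borel_measurable borel"
  by (intro borel_measurable_continuous_onI continuous_intros
      bounded_linear.continuous_on[OF matrix_vector_mul_bounded_linear])

text \<open>Coercivity bounds the weight by a product of one-dimensional Gaussian weights of
  variance \<open>1 / c\<close>, whose integral factorizes over the coordinates.\<close>

lemma gaussian_finite:
  fixes M :: "real^'p^'p"
  assumes c: "0 < c" and M: "coercive c M"
  shows "(\<integral>\<^sup>+x. ennreal (exp (- ((x - m) \<bullet> (M *v (x - m))) / 2)) \<partial>lborel) < \<infinity>"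
proof -
  have 1: "(\<integral>\<^sup>+x. ennreal (exp (- (c * (x - \<mu>)\<^sup>2) / 2)) \<partial>lborel) < \<infinity>" for \<mu> :: real
  proof -
    let ?s = "1 / sqrt c"
    have "exp (- (c * (x - \<mu>)\<^sup>2) / 2) = sqrt (2 * pi * ?s\<^sup>2) * normal_density \<mu> ?s x" for x
      using c by (simp add: normal_density_def power_divide field_simps real_sqrt_mult real_sqrt_divide)
    then have "(\<integral>\<^sup>+x. ennreal (exp (- (c * (x - \<mu>)\<^sup>2) / 2)) \<partial>lborel)
      = (\<integral>\<^sup>+x. ennreal (sqrt (2 * pi * ?s\<^sup>2)) * ennreal (normal_density \<mu> ?s x) \<partial>lborel)"
      using c by (intro nn_integral_cong) (simp add: ennreal_mult'')
    also have "\<dots> = ennreal (sqrt (2 * pi * ?s\<^sup>2)) * (\<integral>\<^sup>+x. ennreal (normal_density \<mu> ?s x) \<partial>lborel)"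
      by (rule nn_integral_cmult) simp
    also have "(\<integral>\<^sup>+x. ennreal (normal_density \<mu> ?s x) \<partial>lborel) = 1"
      using prob_space.emeasure_space_1[OF prob_space_normal_density[of ?s \<mu>]] c
      by (simp add: emeasure_density)
    finally show ?thesis by simp
  qed
  have "(\<integral>\<^sup>+x. ennreal (exp (- ((x - m) \<bullet> (M *v (x - m))) / 2)) \<partial>lborel)
    \<le> (\<integral>\<^sup>+x. (\<Prod>b\<in>Basis. ennreal (exp (- (c * (x \<bullet> b - m \<bullet> b)\<^sup>2) / 2))) \<partial>lborel)"
  proof (rule nn_integral_mono)
    fix x :: "real^'p"
    have "(\<Prod>b\<in>Basis. exp (- (c * (x \<bullet> b - m \<bullet> b)\<^sup>2) / 2)) = exp (- (c * ((x - m) \<bullet> (x - m))) / 2)"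
      by (subst euclidean_inner[of "x - m"])
         (simp add: exp_sum[symmetric] sum_negf sum_divide_distrib[symmetric] sum_distrib_left[symmetric] inner_diff_left power2_eq_square)
    moreover have "c * ((x - m) \<bullet> (x - m)) \<le> (x - m) \<bullet> (M *v (x - m))"
      using M by (simp add: coercive_def)
    ultimately show "ennreal (exp (- ((x - m) \<bullet> (M *v (x - m))) / 2))
      \<le> (\<Prod>b\<in>Basis. ennreal (exp (- (c * (x \<bullet> b - m \<bullet> b)\<^sup>2) / 2)))"
      by (subst prod_ennreal) (auto intro!: ennreal_leI)
  qed
  also have "\<dots> = (\<Prod>b\<in>Basis. \<integral>\<^sup>+x. ennreal (exp (- (c * (x - m \<bullet> b)\<^sup>2) / 2)) \<partial>lborel)"
    by (rule nn_integral_lborel_prod) auto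
  also have "\<dots> < \<infinity>"
    using 1 by (simp add: less_top[symmetric] ennreal_prod_eq_top)
  finally show ?thesis .
qed

lemma gaussian_pos:
  fixes M :: "real^'p^'p"
  shows "(\<integral>\<^sup>+x. ennreal (exp (- ((x - m) \<bullet> (M *v (x - m))) / 2)) \<partial>lborel) \<noteq> 0"
proof
  assume "(\<integral>\<^sup>+x. ennreal (exp (- ((x - m) \<bullet> (M *v (x - m))) / 2)) \<partial>lborel) = 0"
  then have "AE x in lborel. ennreal (exp (- ((x - m) \<bullet> (M *v (x - m))) / 2)) = 0"
    by (subst (asm) nn_integral_0_iff_AE) auto
  then have "AE x in lborel :: (real^'p) measure. False" by simp
  then have "emeasure lborel (UNIV :: (real^'p) set) = 0"
    by (subst (asm) AE_iff_measurable[where N=UNIV]) auto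
  then show False by simp
qed

text \<open>Dilation by \<open>sqrt 2\<close> about \<open>m\<close> doubles the quadratic form, and
  its Jacobian depends on the dimension alone. This is the source of a sublevel radius valid for all
  matrices.\<close>

lemma gaussian_scaling:
  fixes M :: "real^'p^'p"
  shows "(\<integral>\<^sup>+x. ennreal (exp (- ((x - m) \<bullet> (M *v (x - m))) / 4)) \<partial>lborel)
     = ennreal (sqrt 2 ^ CARD('p)) * (\<integral>\<^sup>+x. ennreal (exp (- ((x - m) \<bullet> (M *v (x - m))) / 2)) \<partial>lborel)"
proof -
  \<comment> \<open>Chosen so that the affine map sending \<open>x\<close> to
    \<open>?t + sqrt 2 *\<^sub>R x\<close> fixes \<open>m\<close>.\<close>
  let ?t = "m - sqrt 2 *\<^sub>R m"
  have sh: "?t + sqrt 2 *\<^sub>R x - m = sqrt 2 *\<^sub>R (x - m)" for x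
    by (simp add: algebra_simps)
  have "(\<integral>\<^sup>+x. ennreal (exp (- ((x - m) \<bullet> (M *v (x - m))) / 4)) \<partial>lborel)
    = (\<integral>\<^sup>+x. ennreal (sqrt 2 ^ CARD('p)) * ennreal (exp (- ((?t + sqrt 2 *\<^sub>R x - m) \<bullet> (M *v (?t + sqrt 2 *\<^sub>R x - m))) / 4)) \<partial>lborel)"
    by (subst lborel_affine[of "sqrt 2" ?t])
       (simp_all add: nn_integral_density nn_integral_distr nn_integral_cmult)
  also have "\<dots> = (\<integral>\<^sup>+x. ennreal (sqrt 2 ^ CARD('p)) * ennreal (exp (- ((x - m) \<bullet> (M *v (x - m))) / 2)) \<partial>lborel)"
    unfolding sh
  proof (intro nn_integral_cong arg_cong2[where f="(*)"] arg_cong[where f=ennreal] arg_cong[where f=exp] refl)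
    fix x
    have "(sqrt 2 *\<^sub>R (x - m)) \<bullet> (M *v (sqrt 2 *\<^sub>R (x - m))) = (sqrt 2 * sqrt 2) * ((x - m) \<bullet> (M *v (x - m)))"
      by (simp only: matrix_vector_mult_scaleR inner_scaleR_left inner_scaleR_right mult.assoc)
    then show "- ((sqrt 2 *\<^sub>R (x - m)) \<bullet> (M *v (sqrt 2 *\<^sub>R (x - m)))) / 4 = - ((x - m) \<bullet> (M *v (x - m))) / 2"
      by (simp only: real_sqrt_mult_self)
  qed
  finally show ?thesis by (simp add: nn_integral_cmult)
qed

text \<open>The bound does not depend on the matrix: on the complement of the sublevel set
  \<open>exp (- q / 2) \<le> exp (- r / 4) * exp (- q / 4)\<close>, and scaling turns the last factor into the normalizer.\<close>

lemma gaussian_sublevel: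
  obtains r :: real where "0 < r"
    "\<And>m (M :: real^'p^'p) c. 0 < c \<Longrightarrow> coercive c M \<Longrightarrow>
      ennreal (1/2) \<le> emeasure (ndens lborel (\<lambda>x. exp (- ((x - m) \<bullet> (M *v (x - m))) / 2))) {x. (x - m) \<bullet> (M *v (x - m)) \<le> r}"
proof -
  define k :: real where "k = sqrt 2 ^ CARD('p)"
  have k: "0 < k" "1 \<le> k" by (auto simp: k_def)
  define r where "r = 4 * ln (2 * k)"
  have r: "0 < r" "exp (- r / 4) * k = 1/2"
    using k by (auto simp: r_def exp_minus)
  show thesis
  proof (rule that[OF r(1)])
    fix m and M :: "real^'p^'p" and c :: real
    assume c: "0 < c" "coercive c M"
    let ?q = "\<lambda>x. (x - m) \<bullet> (M *v (x - m))"
    let ?N = "ndens lborel (\<lambda>x. exp (- ?q x / 2))"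
    let ?Z = "\<integral>\<^sup>+x. ennreal (exp (- ?q x / 2)) \<partial>lborel"
    have Z: "?Z \<noteq> 0" "?Z < \<infinity>"
      using gaussian_pos gaussian_finite[OF c] by auto
    interpret prob_space ?N
      by (rule prob_ndens) (use Z in auto)
    have "(\<integral>\<^sup>+x. ennreal (exp (- ?q x / 2)) * indicator {x. r < ?q x} x \<partial>lborel)
      \<le> (\<integral>\<^sup>+x. ennreal (exp (- r / 4)) * ennreal (exp (- ?q x / 4)) \<partial>lborel)"
    proof (rule nn_integral_mono)
      fix x
      have "exp (- ?q x / 2) \<le> exp (- r / 4) * exp (- ?q x / 4)" if "r < ?q x"
        unfolding exp_add[symmetric] using that by simp
      then show "ennreal (exp (- ?q x / 2)) * indicator {x. r < ?q x} x
        \<le> ennreal (exp (- r / 4)) * ennreal (exp (- ?q x / 4))"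
        by (auto simp: ennreal_mult[symmetric] intro!: ennreal_leI split: split_indicator)
    qed
    also have "\<dots> = ennreal (exp (- r / 4)) * (ennreal k * ?Z)"
      unfolding k_def gaussian_scaling[symmetric] by (rule nn_integral_cmult) simp
    also have "\<dots> = ennreal (1/2) * ?Z"
      unfolding mult.assoc[symmetric] by (subst ennreal_mult[symmetric]) (use k in \<open>simp_all only: r(2) less_imp_le exp_ge_zero\<close>)
    finally have *: "(\<integral>\<^sup>+x. ennreal (exp (- ?q x / 2)) * indicator {x. r < ?q x} x \<partial>lborel) \<le> ennreal (1/2) * ?Z" .
    have meas [measurable]: "{x. r < ?q x} \<in> sets lborel" "{x. ?q x \<le> r} \<in> sets lborel"
      by measurable
    have "emeasure ?N {x. r < ?q x} = (\<integral>\<^sup>+x. ennreal (exp (- ?q x / 2)) * indicator {x. r < ?q x} x \<partial>lborel) / ?Z"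
      by (rule emeasure_ndens) measurable
    also have "\<dots> \<le> ennreal (1/2) * ?Z / ?Z"
      by (rule divide_right_mono_ennreal[OF *])
    also have "\<dots> = ennreal (1/2)"
      using Z by (intro ennreal_mult_divide_eq) auto
    finally have "prob {x. r < ?q x} \<le> 1/2"
      unfolding emeasure_eq_measure by (subst (asm) ennreal_le_iff) simp_all
    moreover have "prob {x. ?q x \<le> r} = 1 - prob {x. r < ?q x}"
      using prob_compl[of "{x. r < ?q x}"] meas by (simp add: Compl_eq_Diff_UNIV[symmetric] Collect_neg_eq[symmetric] not_less)
    ultimately have "1/2 \<le> prob {x. ?q x \<le> r}" by simp
    then show "ennreal (1/2) \<le> emeasure ?N {x. ?q x \<le> r}"
      unfolding emeasure_eq_measure by (rule ennreal_leI)
  qed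
qed

subsection \<open>Measurability of matrix operations\<close>

lemma borel_measurable_vec_nth [measurable (raw)]:
  fixes f :: "'a \<Rightarrow> ('b::euclidean_space)^'n"
  shows "f \<in> borel_measurable M \<Longrightarrow> (\<lambda>x. f x $ i) \<in> borel_measurable M"
  by (rule measurable_compose[OF _ borel_measurable_continuous_onI]) (auto intro: continuous_intros)

lemma borel_measurable_vec_lambda [measurable (raw)]:
  fixes f :: "'a \<Rightarrow> 'n::finite \<Rightarrow> 'b::euclidean_space"
  assumes [measurable]: "\<And>i. (\<lambda>x. f x i) \<in> borel_measurable M"
  shows "(\<lambda>x. \<chi> i. f x i) \<in> borel_measurable M"
  by (subst borel_measurable_euclidean_space) (auto simp: Basis_vec_def inner_axis)

lemma borel_measurable_matrix_mult [measurable (raw)]: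
  fixes f :: "'a \<Rightarrow> real^'n^'m" and g :: "'a \<Rightarrow> real^'k^'n"
  assumes [measurable]: "f \<in> borel_measurable M" "g \<in> borel_measurable M"
  shows "(\<lambda>x. f x ** g x) \<in> borel_measurable M"
  unfolding matrix_matrix_mult_def by measurable

lemma borel_measurable_matrix_vector_mult [measurable (raw)]:
  fixes f :: "'a \<Rightarrow> real^'n^'m" and g :: "'a \<Rightarrow> real^'n"
  assumes [measurable]: "f \<in> borel_measurable M" "g \<in> borel_measurable M"
  shows "(\<lambda>x. f x *v g x) \<in> borel_measurable M"
  unfolding matrix_vector_mult_def by measurable

lemma borel_measurable_det [measurable (raw)]:
  fixes f :: "'a \<Rightarrow> real^'n^'n"
  assumes [measurable]: "f \<in> borel_measurable M"
  shows "(\<lambda>x. det (f x)) \<in> borel_measurable M"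
  unfolding det_def by measurable

lemma borel_measurable_diagm [measurable (raw)]:
  assumes [measurable]: "f \<in> borel_measurable M"
  shows "(\<lambda>x. diagm (f x)) \<in> borel_measurable M"
  unfolding diagm_def by measurable

lemma borel_measurable_hadamard [measurable (raw)]:
  assumes [measurable]: "f \<in> borel_measurable M" "g \<in> borel_measurable M"
  shows "(\<lambda>x. hadamard (f x) (g x)) \<in> borel_measurable M"
  unfolding hadamard_def by measurable

lemma matrix_inv_mult:
  assumes "invertible A"
  shows "A ** matrix_inv A = mat 1" "matrix_inv A ** A = mat 1"
  using someI_ex[OF assms[unfolded invertible_def]] by (auto simp: matrix_inv_def)

lemma matrix_inv_eqI:
  fixes A B :: "real^'n^'n"
  assumes "A ** B = mat 1"
  shows "matrix_inv A = B"
proof -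
  have "invertible A" using assms invertible_right_inverse by blast
  then have "matrix_inv A = matrix_inv A ** (A ** B)" by (simp add: assms)
  also have "\<dots> = B"
    by (simp add: matrix_mul_assoc matrix_inv_mult[OF \<open>invertible A\<close>])
  finally show ?thesis .
qed

lemma matrix_inv_scaleR_matrix_inv:
  fixes M :: "real^'n^'n"
  assumes "invertible M" "c \<noteq> 0"
  shows "matrix_inv (c *\<^sub>R matrix_inv M) = (1 / c) *\<^sub>R M"
  using assms by (intro matrix_inv_eqI) (simp add: matrix_inv_mult matrix_scalar_ac scalar_matrix_assoc[symmetric])

text \<open>Needed for measurability. For a singular \<open>A\<close> the predicate under the choice
  operator is identically false, so \<open>matrix_inv A\<close> is one and the same unspecified
  matrix for all of them; elsewhere Cramer's rule gives entries rational in those of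
  \<open>A\<close>.\<close>

lemma matrix_inv_cramer:
  fixes A :: "real^'n^'n"
  shows "matrix_inv A = (if det A = 0 then (SOME B. False)
    else (\<chi> k j. det (\<chi> i l. if l = k then axis j 1 $ i else A $ i $ l) / det A))"
proof (cases "det A = 0")
  case True
  then have "(\<lambda>B. A ** B = mat 1 \<and> B ** A = mat 1) = (\<lambda>B. False)"
    using invertible_det_nz[of A] by (auto simp: invertible_def)
  then show ?thesis using True by (simp add: matrix_inv_def)
next
  case False
  then have inv: "invertible A" by (simp add: invertible_det_nz)
  have "matrix_inv A $ k $ j = det (\<chi> i l. if l = k then axis j 1 $ i else A $ i $ l) / det A" for k j
  proof -
    have "A *v (matrix_inv A *v axis j 1) = axis j 1"
      by (simp add: matrix_vector_mul_assoc matrix_inv_mult[OF inv])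
    then have "matrix_inv A *v axis j 1 = (\<chi> k. det (\<chi> i l. if l = k then axis j 1 $ i else A $ i $ l) / det A)"
      using cramer[OF False] by blast
    then have "(matrix_inv A *v axis j 1) $ k = det (\<chi> i l. if l = k then axis j 1 $ i else A $ i $ l) / det A"
      by (simp only: vec_lambda_beta)
    then show ?thesis
      by (simp only: matrix_vector_mult_basis column_def vec_lambda_beta)
  qed
  then show ?thesis using False by (simp add: vec_eq_iff)
qed

lemma borel_measurable_matrix_inv [measurable (raw)]:
  fixes f :: "'a \<Rightarrow> real^'n^'n"
  assumes [measurable]: "f \<in> borel_measurable M"
  shows "(\<lambda>x. matrix_inv (f x)) \<in> borel_measurable M"
  unfolding matrix_inv_cramer by measurable

subsection \<open>Matrix estimates\<close>

lemma inner_matrix_transpose: "v \<bullet> (transpose (M::real^'n^'m) *v w) = (M *v v) \<bullet> w"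
  by (metis dot_lmul_matrix inner_commute transpose_matrix_vector)

lemma diagm_mult: "diagm l *v v = hadamard l v"
  by (simp add: vec_eq_iff diagm_def hadamard_def matrix_vector_mult_def if_distrib[where f="\<lambda>x. x * _"] cong: if_cong)

lemma inner_hadamard: "hadamard l u \<bullet> v = u \<bullet> hadamard l v"
  by (simp add: inner_vec_def hadamard_def algebra_simps)

lemma inner_XtX: "v \<bullet> (XtX X *v w) = (X *v v) \<bullet> (X *v w)"
  unfolding XtX_def by (simp only: matrix_vector_mul_assoc[symmetric] inner_matrix_transpose)

abbreviation gram :: "real^'p^'n \<Rightarrow> real^'p \<Rightarrow> real^'p^'p" where
  "gram X l \<equiv> diagm l ** XtX X ** diagm l"

lemma inner_gram: "v \<bullet> (gram X l *v w) = (X *v hadamard l v) \<bullet> (X *v hadamard l w)"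
  by (simp only: matrix_vector_mul_assoc[symmetric] diagm_mult inner_hadamard[symmetric] inner_XtX)

lemma scaleR_matrix_vector: "(c *\<^sub>R A) *v v = c *\<^sub>R ((A :: real^'n^'m) *v v)"
  by (simp add: scaleR_matrix_vector_assoc)

lemma coercive_invertible:
  fixes M :: "real^'n^'n"
  assumes "coercive c M" "0 < c"
  shows "invertible M"
proof -
  have "v = 0" if "M *v v = 0" for v
  proof -
    have "c * (v \<bullet> v) \<le> 0" using assms that by (auto simp: coercive_def dest!: spec[of _ v])
    then have "v \<bullet> v \<le> 0" using assms(2) by (simp add: mult_le_0_iff)
    then show ?thesis by (metis antisym inner_eq_zero_iff inner_ge_zero)
  qed
  then have "inj ((*v) M)"
    by (simp add: linear_injective_0)
  then show ?thesis
    using invertible_left_inverse matrix_left_invertible_injective by blast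
qed

lemma coercive_mono: "coercive c M \<Longrightarrow> (\<And>v. 0 \<le> v \<bullet> (N *v v)) \<Longrightarrow> coercive c (M + N)"
  by (fastforce simp: coercive_def matrix_vector_mult_add_rdistrib inner_add_right intro: order_trans)

lemma coercive_scaleR_mat: "coercive c (c *\<^sub>R mat 1)"
  by (simp add: coercive_def scaleR_matrix_vector)

lemma coercive_gram: "0 \<le> t \<Longrightarrow> coercive 1 (mat 1 + t *\<^sub>R gram X l)"
  using coercive_scaleR_mat[of 1]
  by (intro coercive_mono) (simp_all add: scaleR_matrix_vector inner_gram)

lemma solve_coercive:
  fixes M :: "real^'n^'n"
  assumes "coercive c M" "0 < c"
  shows "M *v (matrix_inv M *v v) = v"
  by (simp add: matrix_vector_mul_assoc matrix_inv_mult(1)[OF coercive_invertible[OF assms]])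

lemma le_if_square_le_mult: "x * x \<le> x * y \<Longrightarrow> 0 \<le> x \<Longrightarrow> 0 \<le> y \<Longrightarrow> x \<le> (y::real)"
  by (cases "x = 0") auto

text \<open>Testing the normal equation for \<open>m\<close> against \<open>m\<close> gives
  \<open>m \<bullet> m + ?a \<bullet> ?a = ?a \<bullet> y\<close>, where \<open>?a\<close> is the
  fitted vector. Cauchy-Schwarz bounds \<open>?a\<close> by \<open>y\<close>, and then
  \<open>m\<close>. Neither bound involves \<open>t\<close> or \<open>l\<close>.\<close>

lemma ridge_mean_bounds:
  fixes X :: "real^'p^'n" and y :: "real^'n" and l :: "real^'p"
  assumes t: "0 \<le> t"
  defines "m \<equiv> sqrt t *\<^sub>R (matrix_inv (mat 1 + t *\<^sub>R gram X l) *v (diagm l *v (transpose X *v y)))"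
  shows "norm m \<le> norm y" "norm (X *v (sqrt t *\<^sub>R hadamard l m)) \<le> norm y"
proof -
  let ?M = "mat 1 + t *\<^sub>R gram X l" and ?a = "X *v (sqrt t *\<^sub>R hadamard l m)"
  have "?M *v m = sqrt t *\<^sub>R (diagm l *v (transpose X *v y))"
    unfolding m_def by (simp only: matrix_vector_mult_scaleR solve_coercive[OF coercive_gram[OF t]] zero_less_one)
  then have "m \<bullet> (?M *v m) = ?a \<bullet> y"
    by (simp only: diagm_mult inner_scaleR_right inner_hadamard[symmetric] inner_matrix_transpose
        matrix_vector_mult_scaleR inner_scaleR_left)
  moreover have "m \<bullet> (?M *v m) = m \<bullet> m + ?a \<bullet> ?a"
    using t by (simp only: matrix_vector_mult_add_rdistrib inner_add_right scaleR_matrix_vector inner_gram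
        matrix_vector_mult_scaleR inner_scaleR_left inner_scaleR_right matrix_vector_mul_lid mult.assoc[symmetric] real_sqrt_mult_self abs_of_nonneg)
  ultimately have eq: "m \<bullet> m + ?a \<bullet> ?a = ?a \<bullet> y" by simp
  have "?a \<bullet> y \<le> norm ?a * norm y" by (rule norm_cauchy_schwarz)
  then have le: "norm m * norm m + norm ?a * norm ?a \<le> norm ?a * norm y"
    using eq by (simp add: dot_square_norm power2_eq_square)
  have "norm ?a * norm ?a \<le> norm ?a * norm y"
    using le zero_le_square[of "norm m"] by linarith
  then show a: "norm ?a \<le> norm y" by (rule le_if_square_le_mult) auto
  have "norm m * norm m \<le> norm ?a * norm y"
    using le zero_le_square[of "norm ?a"] by linarith
  also have "\<dots> \<le> norm y * norm y" using a by (simp add: mult_right_mono)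
  finally have "(norm m)\<^sup>2 \<le> (norm y)\<^sup>2" by (simp only: power2_eq_square)
  then show "norm m \<le> norm y"
    by (rule power2_le_imp_le) simp
qed

text \<open>The quadratic form subtracted in \<open>Rfun\<close> equals
  \<open>?a \<bullet> y\<close> for the ridge fit \<open>?a\<close>. Testing the equation for
  \<open>w\<close> against \<open>w\<close> shows that it lies between 0 and
  \<open>y \<bullet> y\<close>, whatever \<open>t\<close> and \<open>l\<close> are.\<close>

lemma Rfun_bounds:
  fixes X :: "real^'p^'n" and y :: "real^'n"
  assumes t: "0 < t"
  shows "b' \<le> Rfun y X b' t l" "Rfun y X b' t l \<le> (y \<bullet> y) / 2 + b'"
proof -
  let ?W = "(1 / t) *\<^sub>R mat 1 + gram X l"
  define w where "w = matrix_inv ?W *v (diagm l *v (transpose X *v y))"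
  let ?a = "X *v hadamard l w"
  have co: "coercive (1 / t) ?W"
    by (intro coercive_mono coercive_scaleR_mat) (simp add: inner_gram)
  have "?W *v w = diagm l *v (transpose X *v y)"
    unfolding w_def using t by (intro solve_coercive[OF co]) simp
  then have "w \<bullet> (?W *v w) = ?a \<bullet> y"
    by (simp only: diagm_mult inner_hadamard[symmetric] inner_matrix_transpose)
  moreover have "w \<bullet> (?W *v w) = (w \<bullet> w) / t + ?a \<bullet> ?a"
    by (simp only: matrix_vector_mult_add_rdistrib inner_add_right scaleR_matrix_vector inner_gram
        inner_scaleR_right matrix_vector_mul_lid) simp
  ultimately have eq: "(w \<bullet> w) / t + ?a \<bullet> ?a = ?a \<bullet> y" by simp
  have R: "Rfun y X b' t l = (y \<bullet> y - ?a \<bullet> y) / 2 + b'"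
  proof -
    have "y \<bullet> ((X ** diagm l ** matrix_inv ?W ** diagm l ** transpose X) *v y) = y \<bullet> ?a"
      unfolding w_def by (simp only: matrix_vector_mul_assoc[symmetric] diagm_mult)
    also have "\<dots> = ?a \<bullet> y" by (rule inner_commute)
    finally show ?thesis unfolding Rfun_def by (simp only:)
  qed
  have nn: "0 \<le> (w \<bullet> w) / t" using t by simp
  then have "0 \<le> ?a \<bullet> y" using eq inner_ge_zero[of ?a] by linarith
  then show "Rfun y X b' t l \<le> (y \<bullet> y) / 2 + b'" unfolding R by simp
  have cs: "?a \<bullet> y \<le> norm ?a * norm y" by (rule norm_cauchy_schwarz)
  have "norm ?a * norm ?a \<le> norm ?a * norm y"
    using eq nn cs by (simp add: dot_square_norm power2_eq_square)
  then have "norm ?a \<le> norm y" by (rule le_if_square_le_mult) auto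
  then have "norm ?a * norm y \<le> norm y * norm y" by (simp add: mult_right_mono)
  then have "?a \<bullet> y \<le> y \<bullet> y" using cs by (simp add: dot_square_norm power2_eq_square)
  then show "b' \<le> Rfun y X b' t l" unfolding R by simp
qed

text \<open>Invertibility of \<open>XtX X\<close> makes \<open>X\<close> injective. The constant
  \<open>B\<close> later converts a bound on \<open>X\<close> applied to a vector into a bound on
  the vector.\<close>

lemma XtX_bounded_below:
  fixes X :: "real^'p^'n"
  assumes "invertible (XtX X)"
  obtains B where "0 < B" "\<And>v. B * norm v \<le> norm (X *v v)"
proof -
  have "v = 0" if "X *v v = 0" for v
  proof -
    have "XtX X *v v = 0"
      by (simp add: XtX_def matrix_vector_mul_assoc[symmetric] that)
    then show ?thesis
      using inj_matrix_vector_mult[OF assms] by (simp add: linear_injective_0)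
  qed
  then have "inj ((*v) X)" by (simp add: linear_injective_0)
  from linear_inj_bounded_below_pos[OF matrix_vector_mul_linear this] that show thesis by blast
qed

lemma posdef_invertible:
  fixes M :: "real^'p^'p"
  assumes "posdef M" shows "invertible M"
proof -
  have "v = 0" if "M *v v = 0" for v
    using assms that unfolding posdef_def by (metis inner_zero_right less_irrefl)
  then have "inj ((*v) M)" by (simp add: linear_injective_0)
  then show ?thesis
    using invertible_left_inverse matrix_left_invertible_injective by blast
qed

lemma posdef_inverse_nonneg:
  fixes M :: "real^'p^'p"
  assumes "posdef M" shows "0 \<le> v \<bullet> (matrix_inv M *v v)"
proof -
  define w where "w = matrix_inv M *v v"
  have "M *v w = v"
    by (simp add: w_def matrix_vector_mul_assoc matrix_inv_mult[OF posdef_invertible[OF assms]])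
  moreover have "0 \<le> w \<bullet> (M *v w)"
    using assms unfolding posdef_def by (cases "w = 0") (auto intro: less_imp_le)
  ultimately show ?thesis by (simp add: w_def inner_commute)
qed

text \<open>The summand with \<open>1 / d\<close> supplies the constant; the inverse of the positive
  definite matrix only adds a nonnegative form.\<close>

lemma coercive_Amat:
  assumes "posdef (matrix_inv (XtX X) - d *\<^sub>R mat 1)"
  shows "coercive (1 / d) (Amat X d)"
  unfolding Amat_def by (intro coercive_mono coercive_scaleR_mat posdef_inverse_nonneg assms)

section \<open>Monotonicity of the determinant\<close>

lemma abs_det_le:
  fixes A :: "real^'n^'n"
  assumes "\<And>i j. \<bar>A $ i $ j\<bar> \<le> k"
  shows "\<bar>det A\<bar> \<le> real (card {p. p permutes (UNIV :: 'n set)}) * k ^ CARD('n)"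
proof -
  have "\<bar>det A\<bar> \<le> (\<Sum>p\<in>{p. p permutes (UNIV :: 'n set)}. \<bar>of_int (sign p) * (\<Prod>i\<in>UNIV. A $ i $ p i)\<bar>)"
    unfolding det_def by (rule sum_abs)
  also have "\<dots> \<le> (\<Sum>p\<in>{p. p permutes (UNIV :: 'n set)}. k ^ CARD('n))"
  proof (rule sum_mono)
    fix p :: "'n \<Rightarrow> 'n"
    have "(\<Prod>i\<in>UNIV. \<bar>A $ i $ p i\<bar>) \<le> (\<Prod>i\<in>(UNIV :: 'n set). k)"
      by (rule prod_mono) (use assms in auto)
    then show "\<bar>of_int (sign p) * (\<Prod>i\<in>UNIV. A $ i $ p i)\<bar> \<le> k ^ CARD('n)"
      by (simp add: abs_mult abs_prod sign_def)
  qed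
  finally show ?thesis by simp
qed

text \<open>\<open>B = (M + N)\<^sup>-\<^sup>1 M\<close> is a contraction for the norm induced by \<open>M\<close>, so the entries of its powers,
  hence the numbers \<open>(det B)\<^sup>n\<close>, stay bounded, which forces \<open>\<bar>det B\<bar> \<le> 1\<close>.\<close>

lemma abs_det_mono:
  fixes M N :: "real^'n^'n"
  assumes M: "coercive 1 M" and sym: "\<And>u v. u \<bullet> (M *v v) = v \<bullet> (M *v u)"
    and N: "\<And>v. 0 \<le> v \<bullet> (N *v v)"
  shows "\<bar>det M\<bar> \<le> \<bar>det (M + N)\<bar>"
proof -
  define B where "B = matrix_inv (M + N) ** M"
  have MN: "invertible (M + N)"
    by (rule coercive_invertible[OF coercive_mono[OF M N]]) simp
  have MB: "(M + N) ** B = M"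
    by (simp add: B_def matrix_mul_assoc matrix_inv_mult[OF MN])
  have contr: "(B *v v) \<bullet> (M *v (B *v v)) \<le> v \<bullet> (M *v v)" for v
  proof -
    \<comment> \<open>From \<open>(M + N) *v w = M *v v\<close> it follows that
      \<open>M *v u = N *v w\<close>. After expanding \<open>v = w + u\<close>, both cross terms
      therefore equal \<open>w \<bullet> (N *v w)\<close>, which is nonnegative.\<close>
    define w u where "w = B *v v" and "u = v - w"
    have "(M + N) *v w = M *v v"
      by (simp add: w_def matrix_vector_mul_assoc MB)
    then have Mu: "M *v u = N *v w"
      by (simp add: u_def matrix_vector_mult_diff_distrib matrix_vector_mult_add_rdistrib algebra_simps)
    have "v \<bullet> (M *v v) = (w + u) \<bullet> (M *v (w + u))" by (simp add: u_def)
    also have "\<dots> = w \<bullet> (M *v w) + w \<bullet> (M *v u) + u \<bullet> (M *v w) + u \<bullet> (M *v u)"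
      by (simp add: matrix_vector_right_distrib inner_add_left inner_add_right)
    also have "\<dots> = w \<bullet> (M *v w) + 2 * (w \<bullet> (N *v w)) + u \<bullet> (M *v u)"
      using sym[of u w] by (simp add: Mu)
    also have "\<dots> \<ge> w \<bullet> (M *v w)"
      using N[of w] M[unfolded coercive_def, rule_format, of u] inner_ge_zero[of u] by linarith
    finally show ?thesis by (simp add: w_def)
  qed
  define P where "P n = ((**) B ^^ n) (mat 1)" for n
  have P: "P 0 = mat 1" "P (Suc n) = B ** P n" for n by (simp_all add: P_def)
  have detP: "det (P n) = det B ^ n" for n by (induction n) (simp_all add: P det_mul)
  have PM: "(P n *v v) \<bullet> (M *v (P n *v v)) \<le> v \<bullet> (M *v v)" for n v
  proof (induction n)
    case (Suc n)
    then show ?case using contr[of "P n *v v"] by (simp add: P matrix_vector_mul_assoc)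
  qed (simp add: P)
  define L where "L = onorm ((*v) M)"
  have L: "v \<bullet> (M *v v) \<le> L * (norm v)\<^sup>2" for v
  proof -
    have "v \<bullet> (M *v v) \<le> norm v * norm (M *v v)" by (rule norm_cauchy_schwarz)
    also have "\<dots> \<le> norm v * (L * norm v)"
      unfolding L_def by (intro mult_left_mono onorm matrix_vector_mul_bounded_linear) simp
    finally show ?thesis by (simp add: power2_eq_square algebra_simps)
  qed
  \<comment> \<open>Coercivity with constant 1 bounds the Euclidean norm by the norm of
    \<open>M\<close>; that norm does not grow along the powers, and on a unit vector its square is
    at most the operator norm \<open>L\<close>.\<close>
  have ent: "\<bar>P n $ i $ j\<bar> \<le> sqrt L" for n i j
  proof -
    have "\<bar>P n $ i $ j\<bar> = \<bar>(P n *v axis j 1) $ i\<bar>"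
      by (simp add: matrix_vector_mult_basis column_def)
    also have "\<dots> \<le> norm (P n *v axis j 1)" by (rule component_le_norm_cart)
    also have "\<dots> \<le> sqrt L"
    proof (rule real_le_rsqrt)
      have "(norm (P n *v axis j 1))\<^sup>2 \<le> (P n *v axis j 1) \<bullet> (M *v (P n *v axis j 1))"
        using M by (simp add: coercive_def dot_square_norm)
      also have "\<dots> \<le> axis j 1 \<bullet> (M *v axis j 1)" by (rule PM)
      also have "\<dots> \<le> L" using L[of "axis j 1"] by simp
      finally show "(norm (P n *v axis j 1))\<^sup>2 \<le> L" .
    qed
    finally show ?thesis .
  qed
  define C where "C = real (card {p. p permutes (UNIV :: 'n set)}) * sqrt L ^ CARD('n)"
  have bd: "\<bar>det B\<bar> ^ n \<le> C" for n
    using abs_det_le[OF ent, of n] by (simp add: detP power_abs C_def)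
  have "\<bar>det B\<bar> \<le> 1"
  proof (rule ccontr)
    assume "\<not> ?thesis"
    then obtain n where "C < \<bar>det B\<bar> ^ n" using real_arch_pow[of "\<bar>det B\<bar>" C] by auto
    with bd[of n] show False by simp
  qed
  moreover have "\<bar>det M\<bar> = \<bar>det (M + N)\<bar> * \<bar>det B\<bar>"
    by (metis MB abs_mult det_mul)
  ultimately show ?thesis
    by (simp add: mult_left_le)
qed

text \<open>\<open>powr\<close> sees only the absolute value of its base, so
  \<open>abs_det_mono\<close> can be applied to powers of determinants without discussing their
  sign.\<close>

lemma powr_abs_base: "\<bar>x\<bar> powr a = (x::real) powr a"
  by (cases "x \<ge> 0") (auto simp: powr_def ln_minus abs_if)

lemma det_gram_powr_antimono:
  assumes "0 \<le> s" "s \<le> t"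
  shows "det (mat 1 + t *\<^sub>R gram X l) powr (-1/2) \<le> det (mat 1 + s *\<^sub>R gram X l) powr (-1/2)"
proof -
  have *: "\<bar>det (mat 1 + r *\<^sub>R gram X l)\<bar> \<le> \<bar>det (mat 1 + r' *\<^sub>R gram X l)\<bar>" if "0 \<le> r" "r \<le> r'" for r r'
  proof -
    have "\<bar>det (mat 1 + r *\<^sub>R gram X l)\<bar> \<le> \<bar>det ((mat 1 + r *\<^sub>R gram X l) + (r' - r) *\<^sub>R gram X l)\<bar>"
      using that
      by (intro abs_det_mono coercive_gram)
         (simp_all add: scaleR_matrix_vector inner_gram matrix_vector_mult_add_rdistrib inner_add_right inner_commute)
    then show ?thesis by (simp add: algebra_simps)
  qed
  have "\<bar>det (mat 1 + t *\<^sub>R gram X l)\<bar> powr (-1/2) \<le> \<bar>det (mat 1 + s *\<^sub>R gram X l)\<bar> powr (-1/2)"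
    \<comment> \<open>The instance from 0 to \<open>s\<close> shows that the smaller base is at
      least 1, hence positive, as the antitone power rule requires.\<close>
    using *[of 0 s] *[OF assms] assms by (intro powr_mono2') auto
  then show ?thesis by (simp only: powr_abs_base)
qed

lemma det_gram_powr_bounds:
  assumes "0 \<le> t"
  shows "0 < det (mat 1 + t *\<^sub>R gram X l) powr (-1/2)" "det (mat 1 + t *\<^sub>R gram X l) powr (-1/2) \<le> 1"
proof -
  show "0 < det (mat 1 + t *\<^sub>R gram X l) powr (-1/2)"
    using coercive_invertible[OF coercive_gram[OF assms]] by (simp add: invertible_det_nz)
  show "det (mat 1 + t *\<^sub>R gram X l) powr (-1/2) \<le> 1"
    using det_gram_powr_antimono[where s=0 and t=t and X=X and l=l] assms by simp
qed

section \<open>Normal laws through their precision matrix\<close>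

lemma mvnormal_eq:
  fixes P :: "real^'p^'p"
  assumes "invertible P" "s \<noteq> 0"
  shows "mvnormal m (s *\<^sub>R matrix_inv P)
    = ndens lborel (\<lambda>x. exp (- ((x - m) \<bullet> (((1 / s) *\<^sub>R P) *v (x - m))) / 2))"
  unfolding mvnormal_def matrix_inv_scaleR_matrix_inv[OF assms] ..

lemma coercive_scaleR: "coercive c P \<Longrightarrow> 0 \<le> k \<Longrightarrow> coercive (k * c) (k *\<^sub>R P)"
  by (auto simp: coercive_def scaleR_matrix_vector mult.assoc intro!: mult_left_mono)

lemma prob_mvnormal:
  fixes P :: "real^'p^'p"
  assumes P: "coercive c P" "0 < c" and s: "0 < s"
  shows "prob_space (mvnormal m (s *\<^sub>R matrix_inv P))"
proof -
  have co: "coercive ((1 / s) * c) ((1 / s) *\<^sub>R P)" "0 < (1 / s) * c"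
    using coercive_scaleR[OF P(1), of "1 / s"] P(2) s by auto
  show ?thesis
    using s unfolding mvnormal_eq[OF coercive_invertible[OF P] less_imp_neq[OF s, symmetric]]
    by (intro prob_ndens gaussian_pos gaussian_finite[OF co(2,1)]) auto
qed

text \<open>The precision is \<open>P\<close> divided by \<open>s\<close>, so the universal radius
  \<open>r\<close> becomes \<open>r * s\<close> when the ellipsoid is written with \<open>P\<close>.
  The order of the quantifiers matters: \<open>r\<close> is chosen before \<open>m\<close>,
  \<open>P\<close> and \<open>s\<close>.\<close>

lemma mvnormal_sublevel:
  obtains r :: real where "0 < r"
    "\<And>m (P :: real^'p^'p) c s. coercive c P \<Longrightarrow> 0 < c \<Longrightarrow> 0 < s \<Longrightarrow>
      ennreal (1/2) \<le> emeasure (mvnormal m (s *\<^sub>R matrix_inv P)) {x. (x - m) \<bullet> (P *v (x - m)) \<le> r * s}"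
proof -
  obtain r :: real where r: "0 < r" and gs: "\<And>m (M :: real^'p^'p) c. 0 < c \<Longrightarrow> coercive c M \<Longrightarrow>
      ennreal (1/2) \<le> emeasure (ndens lborel (\<lambda>x. exp (- ((x - m) \<bullet> (M *v (x - m))) / 2))) {x. (x - m) \<bullet> (M *v (x - m)) \<le> r}"
    using gaussian_sublevel[where 'p='p] by blast
  show thesis
  proof (rule that[OF r])
    fix m and P :: "real^'p^'p" and c s :: real
    assume P: "coercive c P" "0 < c" and s: "0 < s"
    have co: "0 < (1 / s) * c" "coercive ((1 / s) * c) ((1 / s) *\<^sub>R P)"
      using coercive_scaleR[OF P(1), of "1 / s"] P(2) s by auto
    have "{x. (x - m) \<bullet> (((1 / s) *\<^sub>R P) *v (x - m)) \<le> r} = {x. (x - m) \<bullet> (P *v (x - m)) \<le> r * s}"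
      using s by (simp add: scaleR_matrix_vector field_simps)
    then show "ennreal (1/2) \<le> emeasure (mvnormal m (s *\<^sub>R matrix_inv P)) {x. (x - m) \<bullet> (P *v (x - m)) \<le> r * s}"
      using gs[OF co, of m] s
      unfolding mvnormal_eq[OF coercive_invertible[OF P] less_imp_neq[OF s, symmetric]] by simp
  qed
qed

section \<open>Measurability of the kernels and of the state sets\<close>

lemma measurable_invgamma [measurable (raw)]:
  assumes [measurable]: "f \<in> borel_measurable M"
  shows "(\<lambda>x. invgamma a (f x)) \<in> M \<rightarrow>\<^sub>M subprob_algebra borel"
  unfolding invgamma_def by (rule measurable_ndens) measurable

lemma measurable_mvnormal [measurable (raw)]:
  fixes m :: "'a \<Rightarrow> real^'p"
  assumes [measurable]: "m \<in> borel_measurable M" "S \<in> borel_measurable M"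
  shows "(\<lambda>x. mvnormal (m x) (S x)) \<in> M \<rightarrow>\<^sub>M subprob_algebra borel"
  unfolding mvnormal_def by (rule measurable_ndens) measurable

lemma measurable_Rfun [measurable (raw)]:
  fixes X :: "real^'p^'n"
  assumes [measurable]: "t \<in> borel_measurable M" "l \<in> borel_measurable M"
  shows "(\<lambda>x. Rfun y X b' (t x) (l x)) \<in> borel_measurable M"
  unfolding Rfun_def by measurable

lemma measurable_step_c:
  fixes X :: "real^'p^'n"
  assumes [measurable]: "t \<in> borel_measurable M" "l \<in> borel_measurable M"
  shows "(\<lambda>x. step_c y X a' b' d (t x) (l x) TYPE('n)) \<in> M \<rightarrow>\<^sub>M subprob_algebra borel"
  unfolding step_c_def by measurable

lemma measurable_lam_dens:
  fixes \<theta> :: "'a \<Rightarrow> real^'p"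
  assumes [measurable]: "pl \<in> borel_measurable borel" "\<theta> \<in> borel_measurable M" "\<beta> \<in> borel_measurable M"
    "s \<in> borel_measurable M" "t \<in> borel_measurable M"
  shows "(\<lambda>x. ndens lborel (lam_dens pl d (\<theta> x) (\<beta> x) (s x) (t x))) \<in> M \<rightarrow>\<^sub>M subprob_algebra borel"
  unfolding lam_dens_def by (rule measurable_ndens) measurable

lemma measurable_tau_dens2:
  fixes X :: "real^'p^'n"
  assumes [measurable]: "pt \<in> borel_measurable borel" "l \<in> borel_measurable M"
  shows "(\<lambda>x. ndens lborel (tau_dens2 y X a' b' pt (l x))) \<in> M \<rightarrow>\<^sub>M subprob_algebra borel"
  unfolding tau_dens2_def by (rule measurable_ndens) measurable

lemma measurable_tau_dens3:
  fixes X :: "real^'p^'n"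
  assumes [measurable]: "pt \<in> borel_measurable borel" "l \<in> borel_measurable M"
    "\<beta> \<in> borel_measurable M" "s \<in> borel_measurable M"
  shows "(\<lambda>x. ndens lborel (tau_dens3 y X pt (\<beta> x) (s x) (l x))) \<in> M \<rightarrow>\<^sub>M subprob_algebra borel"
  unfolding tau_dens3_def by (rule measurable_ndens) measurable

lemma measurable_fst_borel: "fst \<in> borel \<rightarrow>\<^sub>M borel"
  by (intro borel_measurable_continuous_onI continuous_intros)

lemma measurable_snd_borel: "snd \<in> borel \<rightarrow>\<^sub>M borel"
  by (intro borel_measurable_continuous_onI continuous_intros)

lemma state_components_measurable:
  shows "(\<lambda>x::'p::finite state. fst x) \<in> borel_measurable borel"
    "(\<lambda>x::'p state. fst (snd x)) \<in> borel_measurable borel"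
    "(\<lambda>x::'p state. fst (snd (snd x))) \<in> borel_measurable borel"
    "(\<lambda>x::'p state. fst (snd (snd (snd x)))) \<in> borel_measurable borel"
    "(\<lambda>x::'p state. snd (snd (snd (snd x)))) \<in> borel_measurable borel"
  by (intro measurable_compose[OF _ measurable_fst_borel] measurable_compose[OF _ measurable_snd_borel]
      measurable_ident_sets[OF refl])+

lemma measurable_alg2:
  fixes X :: "real^'p^'n"
  assumes [measurable]: "pt \<in> borel_measurable borel" "pl \<in> borel_measurable borel"
  shows "alg2 y X a' b' d pt pl \<in> borel \<rightarrow>\<^sub>M subprob_algebra borel"
  unfolding alg2_def case_prod_beta'
  apply (rule measurable_bind[OF measurable_lam_dens])
       apply (rule assms state_components_measurable)+
  apply (rule measurable_bind[OF measurable_tau_dens2], measurable)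
  apply (rule measurable_step_c, measurable)
  done

lemma measurable_alg3:
  fixes X :: "real^'p^'n"
  assumes [measurable]: "pt \<in> borel_measurable borel" "pl \<in> borel_measurable borel"
  shows "alg3 y X a' b' d pt pl \<in> borel \<rightarrow>\<^sub>M subprob_algebra borel"
  unfolding alg3_def case_prod_beta'
  apply (rule measurable_bind[OF measurable_lam_dens])
       apply (rule assms state_components_measurable)+
  apply (rule measurable_bind[OF measurable_tau_dens3])
      apply (rule assms measurable_snd)+
    apply (rule measurable_compose[OF measurable_fst], rule state_components_measurable)+
  apply (rule measurable_step_c, measurable)
  done

lemma state_space_measurable: "(state_space :: 'p::finite state set) \<in> sets borel"
proof -
  note [measurable] = state_components_measurable(3,4)
  have "state_space = {x :: 'p state. 0 < fst (snd (snd x)) \<and> 0 < fst (snd (snd (snd x)))}"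
    by (auto simp: state_space_def)
  also have "\<dots> = {x \<in> space borel. 0 < fst (snd (snd x)) \<and> 0 < fst (snd (snd (snd x)))}" by simp
  also have "\<dots> \<in> sets borel" by measurable
  finally show ?thesis .
qed

text \<open>The squares of \<open>\<theta>\<close> and \<open>\<beta>\<close> are bounded relative
  to \<open>s\<close>, since the densities of the next step see them only through such quotients.
  The component \<open>l\<close> is left free because both algorithms redraw it without looking at
  its old value.\<close>

definition small_set :: "real \<Rightarrow> real \<Rightarrow> ('p::finite) state set" where
  "small_set N T = {(\<theta>, \<beta>, s, t, l). 1 \<le> s \<and> 0 < t \<and> t \<le> T \<and> \<theta> \<bullet> \<theta> \<le> N * s \<and> \<beta> \<bullet> \<beta> \<le> N * s}"

lemma small_set_measurable: "(small_set N T :: 'p::finite state set) \<in> sets borel"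
proof -
  note [measurable] = state_components_measurable
  have "small_set N T = {x \<in> space borel. 1 \<le> fst (snd (snd x)) \<and> 0 < fst (snd (snd (snd x))) \<and> fst (snd (snd (snd x))) \<le> T \<and>
     fst x \<bullet> (fst x :: real^'p) \<le> N * fst (snd (snd x)) \<and> fst (snd x) \<bullet> fst (snd x) \<le> N * fst (snd (snd x))}"
    by (auto simp: small_set_def)
  also have "\<dots> \<in> sets borel" by measurable
  finally show ?thesis .
qed

lemma sets_mvnormal [simp]: "sets (mvnormal m S) = sets borel"
  by (simp add: mvnormal_def)

lemma sets_invgamma [simp]: "sets (invgamma a b) = sets borel"
  by (simp add: invgamma_def)

lemma emeasure_UNIV_prob: "prob_space M \<Longrightarrow> sets M = sets borel \<Longrightarrow> 1 \<le> emeasure M UNIV"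
  using prob_space.emeasure_space_1[of M] sets_eq_imp_space_eq[of M borel] by simp

lemma Rfun_pos: "0 < b' \<Longrightarrow> 0 < t \<Longrightarrow> 0 < Rfun y X b' t l"
  using Rfun_bounds(1)[where t=t and X=X and l=l and y=y and b'=b'] by linarith

lemma alpha_pos: "0 < a' \<Longrightarrow> 0 < real n / 2 + a'"
  by (simp add: add_nonneg_pos)

section \<open>The final draws of an iteration\<close>

context
  fixes y :: "real^'n" and X :: "real^'p^'n" and a' b' d :: real
  assumes inv: "invertible (XtX X)" and a': "0 < a'" and b': "0 < b'" and d: "0 < d"
    and pd: "posdef (matrix_inv (XtX X) - d *\<^sub>R mat 1)"
begin

text \<open>The event for each draw may depend on the earlier draws, as it must for ellipsoids with
  moving centre and with radius proportional to \<open>s\<close>. The last factor 1 is the point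
  mass of \<open>return\<close>.\<close>

lemma step_c_ge:
  fixes p :: ennreal and l :: "real^'p" and Ea
  assumes t: "0 < t" and A: "A \<in> sets borel" and E: "Ea \<in> sets borel" "Ea \<subseteq> {0<..}"
    and p: "p \<le> emeasure (invgamma (real CARD('n) / 2 + a') (Rfun y X b' t l)) Ea"
    and Eb: "\<And>s. s \<in> Ea \<Longrightarrow> Eb s \<in> sets borel"
      "\<And>s. s \<in> Ea \<Longrightarrow> q \<le> emeasure (mvnormal (sqrt t *\<^sub>R (matrix_inv (mat 1 + t *\<^sub>R gram X l) *v (diagm l *v (transpose X *v y))))
         (s *\<^sub>R matrix_inv (mat 1 + t *\<^sub>R gram X l))) (Eb s)"
    and Ec: "\<And>s \<beta>. s \<in> Ea \<Longrightarrow> \<beta> \<in> Eb s \<Longrightarrow> Ec s \<beta> \<in> sets borel"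
      "\<And>s \<beta>. s \<in> Ea \<Longrightarrow> \<beta> \<in> Eb s \<Longrightarrow> q' \<le> emeasure (mvnormal (matrix_inv (Amat X d) *v ((sqrt t / d) *\<^sub>R hadamard l \<beta> + bvec y X d))
         (s *\<^sub>R matrix_inv (Amat X d))) (Ec s \<beta>)"
    and sub: "\<And>s \<beta> \<theta>. s \<in> Ea \<Longrightarrow> \<beta> \<in> Eb s \<Longrightarrow> \<theta> \<in> Ec s \<beta> \<Longrightarrow> (\<theta>, \<beta>, s, t, l) \<in> A"
  shows "p * (q * (q' * 1)) \<le> emeasure (step_c y X a' b' d t l TYPE('n)) A"
  unfolding step_c_def
proof (rule emeasure_bind_ge[OF _ _ E(1) A p], goal_cases)
  case 1
  show ?case by measurable
next
  case (3 s)
  show ?case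
  proof (rule emeasure_bind_ge[OF _ _ Eb(1)[OF 3] A Eb(2)[OF 3]], goal_cases)
    case 1
    show ?case by measurable
  next
    case (3 \<beta>)
    note s\<beta> = \<open>s \<in> Ea\<close> 3
    show ?case
    proof (rule emeasure_bind_ge[OF _ _ Ec(1)[OF s\<beta>] A Ec(2)[OF s\<beta>]], goal_cases)
      case 1
      show ?case by measurable
    next
      case (3 \<theta>)
      then show ?case using sub[OF s\<beta> 3] A by (simp add: emeasure_return)
    qed simp
  qed simp
qed simp

lemma step_c_state_space:
  assumes t: "0 < t"
  shows "1 \<le> emeasure (step_c y X a' b' d t l TYPE('n)) state_space"
proof -
  have "1 * (1 * (1 * 1)) \<le> emeasure (step_c y X a' b' d t l TYPE('n)) state_space"
  proof (rule step_c_ge[OF t state_space_measurable, where Ea="{0<..}" and Eb="\<lambda>_. UNIV" and Ec="\<lambda>_ _. UNIV"])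
    show "1 \<le> emeasure (invgamma (real CARD('n) / 2 + a') (Rfun y X b' t l)) {0<..}"
      by (simp add: invgamma_positive[OF alpha_pos[OF a'] Rfun_pos[OF b' t]])
  qed (use t d in \<open>auto intro!: emeasure_UNIV_prob prob_mvnormal[OF coercive_gram] prob_mvnormal[OF coercive_Amat[OF pd]] simp: state_space_def\<close>)
  then show ?thesis by simp
qed

text \<open>All constants precede \<open>t\<close>, \<open>T\<close> and \<open>l\<close>. This is
  possible because one ellipsoid event controls both \<open>\<beta>\<close> and \<open>X\<close>
  applied to its rescaled version, so that a large \<open>l\<close> cannot spoil the mean of
  \<open>\<theta>\<close>.\<close>

lemma step_c_small_set:
  obtains N p :: real where "0 \<le> N" "0 < p"
    "\<And>t T l. 0 < t \<Longrightarrow> t \<le> T \<Longrightarrow> ennreal p \<le> emeasure (step_c y X a' b' d t l TYPE('n)) (small_set N T)"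
proof -
  obtain p where p: "0 < p" and pi: "\<And>\<beta>. b' \<le> \<beta> \<Longrightarrow> \<beta> \<le> (y \<bullet> y) / 2 + b' \<Longrightarrow>
      ennreal p \<le> emeasure (invgamma (real CARD('n) / 2 + a') \<beta>) {1..}"
    using invgamma_atLeast_1[OF alpha_pos[OF a'] b'] by blast
  obtain r :: real where r: "0 < r" and gs: "\<And>m (P :: real^'p^'p) c s. coercive c P \<Longrightarrow> 0 < c \<Longrightarrow> 0 < s \<Longrightarrow>
      ennreal (1/2) \<le> emeasure (mvnormal m (s *\<^sub>R matrix_inv P)) {x. (x - m) \<bullet> (P *v (x - m)) \<le> r * s}"
    using mvnormal_sublevel[where 'p='p] by blast
  obtain B where B: "0 < B" "\<And>v. B * norm v \<le> norm (X *v v)"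
    using XtX_bounded_below[OF inv] by blast
  define L where "L = onorm ((*v) (matrix_inv (Amat X d)))"
  have L: "norm (matrix_inv (Amat X d) *v v) \<le> L * norm v" for v
    unfolding L_def by (rule onorm) (rule matrix_vector_mul_bounded_linear)
  have L0: "0 \<le> L" unfolding L_def by (rule onorm_pos_le) (rule matrix_vector_mul_bounded_linear)
  \<comment> \<open>In units of \<open>sqrt s\<close>: the mean contributes at most
    \<open>norm y\<close>, as \<open>1 \<le> s\<close>, and the deviation inside the ellipsoid at
    most \<open>sqrt r\<close>.\<close>
  define k where "k = norm y + sqrt r"
  have k0: "0 \<le> k" using r by (simp add: k_def)
  \<comment> \<open>The analogue for \<open>\<theta>\<close>: the operator norm \<open>L\<close> of
    the inverse of \<open>Amat\<close> acts on the rescaled \<open>\<beta>\<close>, of size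
    \<open>k / B\<close> before division by \<open>d\<close>, and on \<open>bvec\<close>; the
    deviation costs \<open>sqrt (r * d)\<close> because \<open>Amat\<close> is coercive with
    constant \<open>1 / d\<close>.\<close>
  define k' where "k' = L * (k / (B * d) + norm (bvec y X d)) + sqrt (r * d)"
  have k'0: "0 \<le> k'" unfolding k'_def using L0 k0 B d r by (intro add_nonneg_nonneg mult_nonneg_nonneg divide_nonneg_nonneg) auto
  define N where "N = max (k\<^sup>2) (k'\<^sup>2)"
  show thesis
  \<comment> \<open>The factors are the probability of \<open>1 \<le> s\<close> and one half for
    each of the two normal draws.\<close>
  proof (rule that[of N "p * (1/2 * (1/2))"])
    fix t T :: real and l :: "real^'p" assume t: "0 < t" "t \<le> T"
    let ?m = "sqrt t *\<^sub>R (matrix_inv (mat 1 + t *\<^sub>R gram X l) *v (diagm l *v (transpose X *v y)))"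
    let ?\<mu> = "\<lambda>\<beta>. matrix_inv (Amat X d) *v ((sqrt t / d) *\<^sub>R hadamard l \<beta> + bvec y X d)"
    let ?Eb = "\<lambda>s. {\<beta>. (\<beta> - ?m) \<bullet> ((mat 1 + t *\<^sub>R gram X l) *v (\<beta> - ?m)) \<le> r * s}"
    let ?Ec = "\<lambda>s \<beta>. {\<theta>. (\<theta> - ?\<mu> \<beta>) \<bullet> (Amat X d *v (\<theta> - ?\<mu> \<beta>)) \<le> r * s}"
    have bnd: "\<beta> \<bullet> \<beta> \<le> N * s \<and> \<theta> \<bullet> \<theta> \<le> N * s"
      if s: "1 \<le> s" and \<beta>: "\<beta> \<in> ?Eb s" and \<theta>: "\<theta> \<in> ?Ec s \<beta>" for s \<beta> \<theta>
    proof -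
      have s1: "1 \<le> sqrt s" using s by simp
      define u where "u = \<beta> - ?m"
      let ?D = "\<lambda>v. sqrt t *\<^sub>R hadamard l v"
      have "u \<bullet> ((mat 1 + t *\<^sub>R gram X l) *v u) = u \<bullet> u + (X *v ?D u) \<bullet> (X *v ?D u)"
        using t by (simp only: matrix_vector_mult_add_rdistrib inner_add_right scaleR_matrix_vector inner_gram
            matrix_vector_mult_scaleR inner_scaleR_left inner_scaleR_right matrix_vector_mul_lid
            mult.assoc[symmetric] real_sqrt_mult_self abs_of_nonneg less_imp_le)
      then have uX: "u \<bullet> u + (X *v ?D u) \<bullet> (X *v ?D u) \<le> r * s"
        using \<beta> by (simp add: u_def)
      then have "u \<bullet> u \<le> r * s" "(X *v ?D u) \<bullet> (X *v ?D u) \<le> r * s"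
        using inner_ge_zero[of u] inner_ge_zero[of "X *v ?D u"] by linarith+
      then have nu: "norm u \<le> sqrt r * sqrt s" "norm (X *v ?D u) \<le> sqrt r * sqrt s"
        by (auto simp: norm_eq_sqrt_inner real_sqrt_mult[symmetric])
      have ys: "norm y + sqrt r * sqrt s \<le> k * sqrt s"
        using mult_left_mono[OF s1, of "norm y"] by (simp add: k_def algebra_simps)
      have \<beta>u: "\<beta> = ?m + u" by (simp add: u_def)
      have n\<beta>: "norm \<beta> \<le> k * sqrt s"
        using norm_triangle_ineq[of ?m u] ridge_mean_bounds(1)[where t=t and X=X and l=l and y=y] t nu(1) ys \<beta>u by simp
      have "?D \<beta> = ?D ?m + ?D u"
        by (simp add: \<beta>u vec_eq_iff hadamard_def algebra_simps)
      then have "X *v ?D \<beta> = X *v ?D ?m + X *v ?D u"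
        by (simp add: matrix_vector_right_distrib)
      then have "norm (X *v ?D \<beta>) \<le> k * sqrt s"
        using norm_triangle_ineq[of "X *v ?D ?m" "X *v ?D u"] ridge_mean_bounds(2)[where t=t and X=X and l=l and y=y] t nu(2) ys by simp
      \<comment> \<open>Injectivity of \<open>X\<close> passes the bound on to
        \<open>?D \<beta>\<close> itself, the vector that enters the mean of
        \<open>\<theta>\<close>.\<close>
      then have "B * norm (?D \<beta>) \<le> k * sqrt s"
        using B(2)[of "?D \<beta>"] by linarith
      then have nD: "norm (?D \<beta>) \<le> k * sqrt s / B"
        using B(1) by (simp add: field_simps)
      have "norm (?\<mu> \<beta>) \<le> L * norm ((1 / d) *\<^sub>R ?D \<beta> + bvec y X d)"
        using L[of "(sqrt t / d) *\<^sub>R hadamard l \<beta> + bvec y X d"] by simp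
      also have "L * norm ((1 / d) *\<^sub>R ?D \<beta> + bvec y X d) \<le> L * (k * sqrt s / (B * d) + norm (bvec y X d) * sqrt s)"
      proof (rule mult_left_mono[OF _ L0], rule order_trans[OF norm_triangle_ineq], rule add_mono)
        show "norm ((1 / d) *\<^sub>R ?D \<beta>) \<le> k * sqrt s / (B * d)"
          using divide_right_mono[OF nD, of d] d by (simp add: field_simps)
        show "norm (bvec y X d) \<le> norm (bvec y X d) * sqrt s"
          using mult_left_mono[OF s1, of "norm (bvec y X d)"] by simp
      qed
      also have "\<dots> = L * (k / (B * d) + norm (bvec y X d)) * sqrt s"
        by (simp add: algebra_simps)
      finally have n\<mu>: "norm (?\<mu> \<beta>) \<le> L * (k / (B * d) + norm (bvec y X d)) * sqrt s" .
      let ?w = "\<theta> - ?\<mu> \<beta>"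
      have "(1 / d) * (?w \<bullet> ?w) \<le> ?w \<bullet> (Amat X d *v ?w)"
        using coercive_Amat[OF pd] by (simp add: coercive_def)
      also have "\<dots> \<le> r * s" using \<theta> by simp
      finally have "?w \<bullet> ?w \<le> (r * d) * s" using d by (simp add: field_simps)
      then have "norm ?w \<le> sqrt (r * d) * sqrt s"
        by (simp add: norm_eq_sqrt_inner real_sqrt_mult[symmetric])
      then have n\<theta>: "norm \<theta> \<le> k' * sqrt s"
        using norm_triangle_ineq[of ?w "?\<mu> \<beta>"] n\<mu> by (simp add: k'_def algebra_simps)
      have sq: "v \<bullet> v \<le> c\<^sup>2 * s" if "norm v \<le> c * sqrt s" for v :: "real^'p" and c
      proof -
        have "(norm v)\<^sup>2 \<le> (c * sqrt s)\<^sup>2" using that by (rule power_mono) simp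
        then show ?thesis using s by (simp add: power_mult_distrib dot_square_norm)
      qed
      have "k\<^sup>2 * s \<le> N * s" "k'\<^sup>2 * s \<le> N * s"
        using s by (auto simp: N_def intro!: mult_right_mono)
      then show ?thesis using sq[OF n\<beta>] sq[OF n\<theta>] by linarith
    qed
    have "ennreal p * (ennreal (1/2) * (ennreal (1/2) * 1)) \<le> emeasure (step_c y X a' b' d t l TYPE('n)) (small_set N T)"
    proof (rule step_c_ge[OF t(1) small_set_measurable, where Ea="{1..}" and Eb="?Eb" and Ec="?Ec"])
      show "ennreal p \<le> emeasure (invgamma (real CARD('n) / 2 + a') (Rfun y X b' t l)) {1..}"
        using Rfun_bounds[OF t(1)] by (intro pi)
      show "ennreal (1/2) \<le> emeasure (mvnormal ?m (s *\<^sub>R matrix_inv (mat 1 + t *\<^sub>R gram X l))) (?Eb s)"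
        if "s \<in> {1..}" for s
        using that t by (intro gs[OF coercive_gram]) auto
      show "ennreal (1/2) \<le> emeasure (mvnormal (?\<mu> \<beta>) (s *\<^sub>R matrix_inv (Amat X d))) (?Ec s \<beta>)"
        if "s \<in> {1..}" for s \<beta>
        using that d by (intro gs[OF coercive_Amat[OF pd]]) auto
      show "(\<theta>, \<beta>, s, t, l) \<in> small_set N T" if "s \<in> {1..}" "\<beta> \<in> ?Eb s" "\<theta> \<in> ?Ec s \<beta>" for s \<beta> \<theta>
        using bnd[OF _ that(2,3)] that(1) t by (simp add: small_set_def)
    qed (auto intro: sets_lborel[THEN equalityD1, THEN subsetD] simp del: sets_lborel)
    moreover have "ennreal (p * (1/2 * (1/2))) = ennreal p * ennreal (1/2 * (1/2))"
      using p by (intro ennreal_mult) auto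
    moreover have "ennreal (1/2 * (1/2)) = ennreal (1/2) * ennreal (1/2)"
      by (intro ennreal_mult) auto
    ultimately show "ennreal (p * (1/2 * (1/2))) \<le> emeasure (step_c y X a' b' d t l TYPE('n)) (small_set N T)"
      by (simp only: mult_1_right)
  qed (use p in \<open>auto simp: N_def le_max_iff_disj\<close>)
qed

end

text \<open>An upper bound \<open>Z\<close> on the normalizer turns a lower bound on the
  unnormalized density into one on the normalized density, and hence into a minorizing
  measure.\<close>

lemma nn_integral_density_le_ndens:
  assumes [measurable]: "f \<in> borel_measurable M" "w \<in> borel_measurable M" "g \<in> borel_measurable M"
    and Z: "(\<integral>\<^sup>+x. ennreal (f x) \<partial>M) \<le> ennreal Z" and Z0: "0 < Z"
    and w: "AE x in M. Z * w x \<le> f x"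
  shows "(\<integral>\<^sup>+x. ennreal (w x) * g x \<partial>M) \<le> (\<integral>\<^sup>+x. g x \<partial>ndens M f)"
proof -
  have "(\<integral>\<^sup>+x. ennreal (w x) * g x \<partial>M) \<le> (\<integral>\<^sup>+x. (ennreal (f x) / (\<integral>\<^sup>+x. ennreal (f x) \<partial>M)) * g x \<partial>M)"
  proof (intro nn_integral_mono_AE)
    show "AE x in M. ennreal (w x) * g x \<le> (ennreal (f x) / (\<integral>\<^sup>+x. ennreal (f x) \<partial>M)) * g x"
      using w
    proof eventually_elim
      case (elim x)
      have "ennreal (w x) = ennreal (Z * w x) / ennreal Z"
        using Z0 by (cases "0 \<le> w x") (auto simp: divide_ennreal mult_less_0_iff ennreal_neg mult_le_0_iff)
      also have "\<dots> \<le> ennreal (f x) / ennreal Z"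
        by (intro divide_right_mono_ennreal ennreal_leI elim)
      also have "\<dots> \<le> ennreal (f x) / (\<integral>\<^sup>+x. ennreal (f x) \<partial>M)"
        by (rule divide_left_mono_ennreal[OF Z])
      finally show ?case by (rule mult_right_mono) simp
    qed
  qed
  also have "\<dots> = (\<integral>\<^sup>+x. g x \<partial>ndens M f)"
    unfolding ndens_def by (rule nn_integral_density[symmetric]) auto
  finally show ?thesis .
qed

lemma prod_Basis_cart:
  fixes f :: "real^'n \<Rightarrow> 'b::comm_monoid_mult"
  shows "(\<Prod>b\<in>Basis. f b) = (\<Prod>k\<in>UNIV. f (axis k 1))"
proof -
  have B: "(Basis :: (real^'n) set) = (\<lambda>k. axis k 1) ` UNIV" by (auto simp: Basis_vec_def)
  have I: "inj (\<lambda>k::'n. axis k (1::real))" by (auto simp: inj_on_def axis_eq_axis)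
  show ?thesis unfolding B by (simp only: prod.reindex[OF I] o_def)
qed

lemma nn_integral_vec_prod:
  assumes [measurable]: "g \<in> borel_measurable borel"
  shows "(\<integral>\<^sup>+l. (\<Prod>k\<in>UNIV. g ((l :: real^'p) $ k)) \<partial>lborel) = (\<integral>\<^sup>+x. g x \<partial>lborel) ^ CARD('p)"
proof -
  have "(\<integral>\<^sup>+l. (\<Prod>k\<in>UNIV. g ((l :: real^'p) $ k)) \<partial>lborel)
    = (\<integral>\<^sup>+l. (\<Prod>b\<in>Basis. g ((l :: real^'p) \<bullet> b)) \<partial>lborel)"
    by (simp add: prod_Basis_cart inner_axis)
  also have "\<dots> = (\<integral>\<^sup>+x. g x \<partial>lborel) ^ CARD('p)"
    by (subst nn_integral_lborel_prod) simp_all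
  finally show ?thesis .
qed

lemma norm_hadamard_le: "norm (hadamard u v) \<le> norm u * norm v"
proof -
  have "hadamard u v \<bullet> hadamard u v = (\<Sum>k\<in>UNIV. (u $ k * u $ k) * (v $ k * v $ k))"
    by (simp add: inner_vec_def hadamard_def algebra_simps)
  also have "\<dots> \<le> (\<Sum>k\<in>UNIV. (u $ k * u $ k) * (v \<bullet> v))"
  proof (intro sum_mono mult_left_mono)
    fix k
    show "v $ k * v $ k \<le> v \<bullet> v"
      using member_le_sum[of k UNIV "\<lambda>i. v $ i * v $ i"] by (simp add: inner_vec_def)
  qed simp
  also have "\<dots> = (u \<bullet> u) * (v \<bullet> v)"
    by (simp add: sum_distrib_right[symmetric] inner_vec_def)
  finally have "(norm (hadamard u v))\<^sup>2 \<le> (norm u * norm v)\<^sup>2"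
    by (simp add: dot_square_norm power_mult_distrib)
  then show ?thesis by (rule power2_le_imp_le) simp
qed

context
  fixes y :: "real^'n" and X :: "real^'p^'n" and a' b' d :: real and pt pl :: "real \<Rightarrow> real"
  assumes inv: "invertible (XtX X)" and a': "0 < a'" and b': "0 < b'" and d: "0 < d"
    and pd: "posdef (matrix_inv (XtX X) - d *\<^sub>R mat 1)"
    and pt0: "\<And>t. 0 \<le> pt t" and pt_meas [measurable]: "pt \<in> borel_measurable borel"
    and pt1: "(\<integral>\<^sup>+t\<in>{0<..}. ennreal (pt t) \<partial>lborel) = 1"
    and pl0: "\<And>l. 0 \<le> pl l" and pl_meas [measurable]: "pl \<in> borel_measurable borel"
    and pl1: "(\<integral>\<^sup>+l. ennreal (pl l) \<partial>lborel) = 1"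
begin

subsection \<open>The density of the local scales\<close>

lemma lam_prior: "(\<integral>\<^sup>+l. ennreal (\<Prod>k\<in>UNIV. pl ((l :: real^'p) $ k)) \<partial>lborel) = 1"
  using nn_integral_vec_prod[of "\<lambda>x. ennreal (pl x)", where 'p='p] by (simp add: pl1 prod_ennreal pl0)

text \<open>If \<open>w\<close> had integral zero, the prior would vanish almost everywhere, against
  its total mass 1. This serves both for normalizers and for showing that minorizing measures are
  not null.\<close>

lemma tilted_lam_prior_pos:
  fixes w :: "real^'p \<Rightarrow> real"
  assumes [measurable]: "w \<in> borel_measurable borel"
    and w: "\<And>l. (\<Prod>k\<in>UNIV. pl (l $ k)) \<noteq> 0 \<Longrightarrow> 0 < w l"
  shows "0 < (\<integral>\<^sup>+l. ennreal (w l) \<partial>lborel)"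
proof (rule ccontr)
  assume "\<not> ?thesis"
  then have "(\<integral>\<^sup>+l. ennreal (w l) \<partial>lborel) = 0" by simp
  then have "AE l in lborel. ennreal (w l) = 0" by (subst (asm) nn_integral_0_iff_AE) auto
  then have "AE l in lborel. ennreal (\<Prod>k\<in>UNIV. pl ((l :: real^'p) $ k)) = 0"
  proof eventually_elim
    case (elim l)
    then show ?case using w[of l] by (metis ennreal_0 ennreal_eq_0_iff not_less)
  qed
  then have "(\<integral>\<^sup>+l. ennreal (\<Prod>k\<in>UNIV. pl ((l :: real^'p) $ k)) \<partial>lborel) = 0"
    by (subst nn_integral_0_iff_AE) auto
  then show False by (simp add: lam_prior)
qed

lemma lam_dens_meas [measurable]: "lam_dens pl d (\<theta> :: real^'p) \<beta> s t \<in> borel_measurable borel"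
  unfolding lam_dens_def by measurable

text \<open>The Gaussian factors are at most 1, so the prior dominates the density. The resulting
  bound 1 on the normalizer is reused in the minorization.\<close>

lemma lam_dens_total:
  assumes "0 < s"
  shows "(\<integral>\<^sup>+l. ennreal (lam_dens pl d (\<theta> :: real^'p) \<beta> s t l) \<partial>lborel) \<le> ennreal 1"
    and "prob_space (ndens lborel (lam_dens pl d \<theta> \<beta> s t))"
proof -
  have "lam_dens pl d \<theta> \<beta> s t l \<le> (\<Prod>k\<in>UNIV. pl (l $ k))" for l
    unfolding lam_dens_def using assms d pl0
    by (intro prod_mono conjI mult_nonneg_nonneg mult_left_le_one_le) (auto simp: divide_nonpos_pos)
  then have "(\<integral>\<^sup>+l. ennreal (lam_dens pl d \<theta> \<beta> s t l) \<partial>lborel) \<le> (\<integral>\<^sup>+l. ennreal (\<Prod>k\<in>UNIV. pl ((l :: real^'p) $ k)) \<partial>lborel)"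
    by (intro nn_integral_mono ennreal_leI)
  then show le: "(\<integral>\<^sup>+l. ennreal (lam_dens pl d \<theta> \<beta> s t l) \<partial>lborel) \<le> ennreal 1"
    by (simp add: lam_prior)
  have "0 < (\<integral>\<^sup>+l. ennreal (lam_dens pl d \<theta> \<beta> s t l) \<partial>lborel)"
  proof (rule tilted_lam_prior_pos)
    fix l :: "real^'p" assume "(\<Prod>k\<in>UNIV. pl (l $ k)) \<noteq> 0"
    then have "0 < pl (l $ k)" for k using pl0[of "l $ k"] by (simp add: less_le)
    then show "0 < lam_dens pl d \<theta> \<beta> s t l"
      unfolding lam_dens_def by (intro prod_pos) simp
  qed simp
  then show "prob_space (ndens lborel (lam_dens pl d \<theta> \<beta> s t))"
    using le by (intro prob_ndens) (auto intro: le_less_trans)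
qed

text \<open>The worst case of \<open>lam_dens\<close> over \<open>small_set N T\<close>, coordinate
  by coordinate; it depends on no component of the state.\<close>

definition lam_minor :: "real \<Rightarrow> real \<Rightarrow> real^'p \<Rightarrow> real" where
  "lam_minor N T l = (\<Prod>k\<in>UNIV. exp (- (T * (l $ k)\<^sup>2 * N + N) / d) * pl (l $ k))"

lemma lam_minor_meas [measurable]: "lam_minor N T \<in> borel_measurable borel"
  unfolding lam_minor_def by measurable

lemma lam_minor_le:
  assumes "(\<theta>, \<beta>, s, t, l0) \<in> small_set N T" "0 \<le> N"
  shows "lam_minor N T l \<le> lam_dens pl d \<theta> \<beta> s t l"
  unfolding lam_minor_def lam_dens_def
proof (intro prod_mono conjI mult_right_mono mult_nonneg_nonneg pl0 exp_ge_zero)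
  fix k
  have s: "1 \<le> s" "0 < t" "t \<le> T" "\<theta> \<bullet> \<theta> \<le> N * s" "\<beta> \<bullet> \<beta> \<le> N * s"
    using assms by (auto simp: small_set_def)
  have comp: "(v $ k)\<^sup>2 \<le> v \<bullet> v" for v :: "real^'p"
    using member_le_sum[of k UNIV "\<lambda>i. v $ i * v $ i"] by (simp add: inner_vec_def power2_eq_square)
  let ?a = "sqrt t * l $ k * \<beta> $ k"
  \<comment> \<open>The factor 2 of this splitting cancels against the 2 in the exponent, and
    \<open>s\<close> cancels since both squares are bounded by multiples of
    \<open>s\<close>.\<close>
  have "(?a - \<theta> $ k)\<^sup>2 \<le> 2 * ?a\<^sup>2 + 2 * (\<theta> $ k)\<^sup>2"
    using zero_le_power2[of "?a + \<theta> $ k"] by (simp add: power2_eq_square algebra_simps)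
  also have "?a\<^sup>2 = t * (l $ k)\<^sup>2 * (\<beta> $ k)\<^sup>2"
    using s by (simp add: power_mult_distrib)
  also have "t * (l $ k)\<^sup>2 * (\<beta> $ k)\<^sup>2 \<le> T * (l $ k)\<^sup>2 * (N * s)"
    using s comp[of \<beta>] assms(2) by (intro mult_mono mult_right_mono mult_nonneg_nonneg) auto
  also have "(\<theta> $ k)\<^sup>2 \<le> N * s" using comp[of \<theta>] s by simp
  finally have "(?a - \<theta> $ k)\<^sup>2 \<le> 2 * s * (T * (l $ k)\<^sup>2 * N + N)"
    by (simp add: algebra_simps)
  then have "(?a - \<theta> $ k)\<^sup>2 / (2 * d * s) \<le> 2 * s * (T * (l $ k)\<^sup>2 * N + N) / (2 * d * s)"
    using s d by (intro divide_right_mono) auto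
  also have "2 * s * q / (2 * d * s) = q / d" for q
    using s d by (simp add: field_simps)
  finally show "exp (- (T * (l $ k)\<^sup>2 * N + N) / d) \<le> exp (- (?a - \<theta> $ k)\<^sup>2 / (2 * d * s))"
    by (simp only: exp_le_cancel_iff minus_divide_left[symmetric] neg_le_iff_le)
qed

subsection \<open>The densities of the global scale\<close>

lemma pt_not_null:
  assumes [measurable]: "w \<in> borel_measurable borel"
    and w: "\<And>t. 0 < t \<Longrightarrow> pt t \<noteq> 0 \<Longrightarrow> 0 < w t"
  shows "(\<integral>\<^sup>+t. ennreal (w t) \<partial>lborel) \<noteq> 0"
proof
  assume "(\<integral>\<^sup>+t. ennreal (w t) \<partial>lborel) = 0"
  then have "AE t in lborel. ennreal (w t) = 0" by (subst (asm) nn_integral_0_iff_AE) auto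
  then have "AE t in lborel. ennreal (pt t) * indicator {0<..} t = 0"
  proof eventually_elim
    case (elim t)
    then show ?case using w[of t] by (cases "0 < t \<and> pt t \<noteq> 0") (auto simp: ennreal_eq_0_iff)
  qed
  then have "(\<integral>\<^sup>+t. ennreal (pt t) * indicator {0<..} t \<partial>lborel) = 0"
    by (subst nn_integral_0_iff_AE) auto
  then show False by (simp add: pt1)
qed

lemma tau_dens2_meas [measurable]: "tau_dens2 y X a' b' pt l \<in> borel_measurable borel"
  unfolding tau_dens2_def by measurable

lemma tau_dens3_meas [measurable]: "tau_dens3 y X pt \<beta> s l \<in> borel_measurable borel"
  unfolding tau_dens3_def by measurable

lemma Rfun_powr_bounds:
  assumes t: "0 < t"
  defines "\<alpha> \<equiv> real CARD('n) / 2 + a'"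
  shows "((y \<bullet> y) / 2 + b') powr (- \<alpha>) \<le> Rfun y X b' t l powr (- \<alpha>)"
    "Rfun y X b' t l powr (- \<alpha>) \<le> b' powr (- \<alpha>)"
proof -
  have \<alpha>: "- \<alpha> \<le> 0" using alpha_pos[OF a', of "CARD('n)"] by (simp add: \<alpha>_def)
  have R: "b' \<le> Rfun y X b' t l" "Rfun y X b' t l \<le> (y \<bullet> y) / 2 + b'"
    using Rfun_bounds[OF t] by auto
  show "((y \<bullet> y) / 2 + b') powr (- \<alpha>) \<le> Rfun y X b' t l powr (- \<alpha>)"
    using R b' by (intro powr_mono2' \<alpha>) auto
  show "Rfun y X b' t l powr (- \<alpha>) \<le> b' powr (- \<alpha>)"
    using R b' by (intro powr_mono2' \<alpha>) auto
qed

lemma tau_dens2_pos: "0 < t \<Longrightarrow> pt t \<noteq> 0 \<Longrightarrow> 0 < tau_dens2 y X a' b' pt l t"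
  using det_gram_powr_bounds(1)[where t=t and X=X and l=l] Rfun_pos[OF b', where t=t and X=X and l=l and y=y] pt0[of t]
  by (simp add: tau_dens2_def less_le)

text \<open>The determinant factor is at most 1 and \<open>Rfun\<close> is at least
  \<open>b'\<close>, so a multiple of the prior dominates the density.\<close>

lemma prob_tau_dens2: "prob_space (ndens lborel (tau_dens2 y X a' b' pt l))"
proof (rule prob_ndens)
  let ?\<alpha> = "real CARD('n) / 2 + a'"
  show "(\<integral>\<^sup>+t. ennreal (tau_dens2 y X a' b' pt l t) \<partial>lborel) \<noteq> 0"
    by (rule pt_not_null) (auto intro: tau_dens2_pos)
  have "(\<integral>\<^sup>+t. ennreal (tau_dens2 y X a' b' pt l t) \<partial>lborel)
    \<le> (\<integral>\<^sup>+t. ennreal (b' powr (- ?\<alpha>)) * (ennreal (pt t) * indicator {0<..} t) \<partial>lborel)"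
  proof (rule nn_integral_mono)
    fix t
    have "tau_dens2 y X a' b' pt l t \<le> pt t * 1 * b' powr (- ?\<alpha>)" if "0 < t"
      using det_gram_powr_bounds[where t=t and X=X and l=l] Rfun_powr_bounds(2)[OF that, of l] that pt0[of t]
      unfolding tau_dens2_def by (simp only: if_True) (intro mult_mono, auto)
    then show "ennreal (tau_dens2 y X a' b' pt l t) \<le> ennreal (b' powr (- ?\<alpha>)) * (ennreal (pt t) * indicator {0<..} t)"
      by (cases "0 < t") (auto simp: ennreal_mult[symmetric] pt0 mult.commute tau_dens2_def intro!: ennreal_leI)
  qed
  also have "\<dots> = ennreal (b' powr (- ?\<alpha>)) * 1"
    by (subst nn_integral_cmult) (simp_all add: pt1)
  also have "\<dots> < \<infinity>" by simp
  finally show "(\<integral>\<^sup>+t. ennreal (tau_dens2 y X a' b' pt l t) \<partial>lborel) < \<infinity>" .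
qed simp

lemma tau_dens2_positive: "1 \<le> emeasure (ndens lborel (tau_dens2 y X a' b' pt l)) {0<..}"
proof -
  have "1 = emeasure (ndens lborel (tau_dens2 y X a' b' pt l)) UNIV"
    using prob_space.emeasure_space_1[OF prob_tau_dens2] by simp
  also have "\<dots> = emeasure (ndens lborel (tau_dens2 y X a' b' pt l)) {0<..}"
    by (subst (1 2) emeasure_ndens)
       (auto intro!: arg_cong2[where f="(/)"] nn_integral_cong simp: tau_dens2_def split: split_indicator)
  finally show ?thesis by simp
qed

text \<open>The intervals up to \<open>Suc n\<close> exhaust the half-line, so not all of them can
  be null for the prior. The resulting \<open>T\<close> depends on the prior alone and becomes the
  bound of the small set for Algorithm 2.\<close>

lemma prior_mass_bounded:
  obtains T q :: real where "0 < T" "0 < q" "(\<integral>\<^sup>+t. ennreal (pt t) * indicator {0<..T} t \<partial>lborel) = ennreal q"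
proof -
  let ?I = "\<lambda>T. \<integral>\<^sup>+t. ennreal (pt t) * indicator {0<..T} t \<partial>lborel"
  have "\<exists>n. ?I (real (Suc n)) \<noteq> 0"
  proof (rule ccontr)
    assume "\<not> ?thesis"
    then have "AE t in lborel. ennreal (pt t) * indicator {0<..real (Suc n)} t = 0" for n
      by (subst nn_integral_0_iff_AE[symmetric]) auto
    then have "AE t in lborel. \<forall>n. ennreal (pt t) * indicator {0<..real (Suc n)} t = 0"
      by (subst AE_all_countable) blast
    then have "AE t in lborel. ennreal (pt t) * indicator {0<..} t = 0"
    proof eventually_elim
      case (elim t)
      obtain n where "t \<le> real n" using real_arch_simple by blast
      then show ?case using elim[rule_format, of n] by (auto split: split_indicator_asm split_indicator)
    qed
    then have "(\<integral>\<^sup>+t. ennreal (pt t) * indicator {0<..} t \<partial>lborel) = 0"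
      by (subst nn_integral_0_iff_AE) auto
    then show False by (simp add: pt1)
  qed
  then obtain n where n: "?I (real (Suc n)) \<noteq> 0" by blast
  have "?I (real (Suc n)) \<le> (\<integral>\<^sup>+t. ennreal (pt t) * indicator {0<..} t \<partial>lborel)"
    by (intro nn_integral_mono) (auto split: split_indicator)
  then have le: "?I (real (Suc n)) \<le> 1" by (simp only: pt1)
  then have e: "?I (real (Suc n)) = ennreal (enn2real (?I (real (Suc n))))"
    by (intro ennreal_enn2real[symmetric]) (auto intro: le_less_trans)
  then have "0 < enn2real (?I (real (Suc n)))"
    using n by (metis ennreal_0 enn2real_nonneg less_le)
  with e show thesis by (intro that[of "real (Suc n)"]) auto
qed

text \<open>For masses \<open>J\<close> inside and \<open>K\<close> outside a set. The common factor
  \<open>e\<close> cancels; this matters because in the application it varies with \<open>l\<close>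
  and can be arbitrarily small.\<close>

lemma ennreal_ratio_ge:
  fixes J K :: ennreal
  assumes J: "ennreal (e * u) \<le> J" and K: "K \<le> ennreal (e * v)" and JK: "J + K < \<infinity>"
    and pos: "0 < e" "0 < u" "0 < v"
  shows "ennreal (u / (u + v)) \<le> J / (J + K)"
proof -
  obtain j where j: "J = ennreal j" "0 \<le> j" using JK by (cases J) auto
  obtain k where k: "K = ennreal k" "0 \<le> k" using JK by (cases K) auto
  have ju: "e * u \<le> j" using J j by simp
  have kv: "k \<le> e * v" using K pos k by (simp add: j)
  have "0 < j" using ju pos by (meson less_le_trans mult_pos_pos)
  have "u * k \<le> u * (e * v)" using kv pos by (intro mult_left_mono) auto
  also have "\<dots> = (e * u) * v" by simp
  also have "\<dots> \<le> j * v" using ju pos by (intro mult_right_mono) auto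
  finally have "u / (u + v) \<le> j / (j + k)"
    using pos \<open>0 < j\<close> k(2) by (simp add: divide_simps add_pos_nonneg algebra_simps)
  then show ?thesis
    using j k \<open>0 < j\<close> by (simp add: divide_ennreal ennreal_leI flip: ennreal_plus)
qed

text \<open>The determinant factor is decreasing in \<open>t\<close> and the other factors of the likelihood are bounded
  above and below, so the posterior mass of \<open>(0, T]\<close> is at least a constant multiple of the prior mass.\<close>

lemma tau_dens2_tight:
  obtains T p :: real where "0 < T" "0 < p"
    "\<And>l. ennreal p \<le> emeasure (ndens lborel (tau_dens2 y X a' b' pt l)) {0<..T}"
proof -
  let ?\<alpha> = "real CARD('n) / 2 + a'"
  define lo hi where "lo = ((y \<bullet> y) / 2 + b') powr (- ?\<alpha>)" and "hi = b' powr (- ?\<alpha>)"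
  have lohi: "0 < lo" "0 < hi"
    using b' add_nonneg_pos[of "(y \<bullet> y) / 2" b'] by (auto simp: lo_def hi_def)
  obtain T q :: real where T: "0 < T" and q: "0 < q"
    and qI: "(\<integral>\<^sup>+t. ennreal (pt t) * indicator {0<..T} t \<partial>lborel) = ennreal q"
    using prior_mass_bounded by blast
  show thesis
  proof (rule that[OF T, of "lo * q / (lo * q + hi)"])
    show "0 < lo * q / (lo * q + hi)" using lohi q by (simp add: add_pos_pos)
    fix l
    let ?f = "tau_dens2 y X a' b' pt l"
    \<comment> \<open>The determinant factor at the cut \<open>T\<close> is a lower bound for it on
      the left of \<open>T\<close> and an upper bound on the right.\<close>
    define e where "e = det (mat 1 + T *\<^sub>R gram X l) powr (-1/2)"
    have e: "0 < e" unfolding e_def using T by (intro det_gram_powr_bounds) simp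
    let ?J = "\<integral>\<^sup>+t. ennreal (?f t) * indicator {0<..T} t \<partial>lborel"
    let ?K = "\<integral>\<^sup>+t. ennreal (?f t) * indicator {T<..} t \<partial>lborel"
    have f: "?f t = pt t * det (mat 1 + t *\<^sub>R gram X l) powr (-1/2) * Rfun y X b' t l powr (- ?\<alpha>)" if "0 < t" for t
      using that by (simp add: tau_dens2_def)
    have J: "ennreal (e * (lo * q)) \<le> ?J"
    proof -
      have "ennreal (e * (lo * q)) = ennreal (e * lo) * (\<integral>\<^sup>+t. ennreal (pt t) * indicator {0<..T} t \<partial>lborel)"
        unfolding qI using e lohi q by (simp add: ennreal_mult[symmetric] mult.assoc)
      also have "\<dots> = (\<integral>\<^sup>+t. ennreal (e * lo) * (ennreal (pt t) * indicator {0<..T} t) \<partial>lborel)"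
        by (rule nn_integral_cmult[symmetric]) simp
      also have "\<dots> \<le> ?J"
      proof (rule nn_integral_mono)
        fix t
        have "pt t * e * lo \<le> ?f t" if "0 < t" "t \<le> T"
          unfolding f[OF that(1)] e_def lo_def using that pt0[of t]
          by (intro mult_mono mult_left_mono det_gram_powr_antimono Rfun_powr_bounds) auto
        then show "ennreal (e * lo) * (ennreal (pt t) * indicator {0<..T} t) \<le> ennreal (?f t) * indicator {0<..T} t"
          using e lohi
          by (auto simp: ennreal_mult[symmetric] pt0 ac_simps intro!: ennreal_leI split: split_indicator)
      qed
      finally show ?thesis .
    qed
    have K: "?K \<le> ennreal (e * hi)"
    proof -
      have "?K \<le> (\<integral>\<^sup>+t. ennreal (e * hi) * (ennreal (pt t) * indicator {0<..} t) \<partial>lborel)"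
      proof (rule nn_integral_mono)
        fix t
        have "?f t \<le> pt t * e * hi" if "T < t"
        proof -
          have "0 < t" using that T by simp
          show ?thesis
            unfolding f[OF \<open>0 < t\<close>] e_def hi_def using that T pt0[of t]
            by (intro mult_mono mult_left_mono det_gram_powr_antimono Rfun_powr_bounds) auto
        qed
        then show "ennreal (?f t) * indicator {T<..} t \<le> ennreal (e * hi) * (ennreal (pt t) * indicator {0<..} t)"
          using e lohi T
          by (auto simp: ennreal_mult[symmetric] pt0 ac_simps intro!: ennreal_leI split: split_indicator)
      qed
      also have "\<dots> = ennreal (e * hi) * 1"
        by (subst nn_integral_cmult) (simp_all add: pt1)
      finally show ?thesis by simp
    qed
    have "(\<integral>\<^sup>+t. ennreal (?f t) \<partial>lborel)
      = (\<integral>\<^sup>+t. ennreal (?f t) * indicator {0<..T} t + ennreal (?f t) * indicator {T<..} t \<partial>lborel)"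
      using T by (intro nn_integral_cong) (auto simp: tau_dens2_def split: split_indicator)
    also have "\<dots> = ?J + ?K" by (rule nn_integral_add) auto
    finally have Z: "(\<integral>\<^sup>+t. ennreal (?f t) \<partial>lborel) = ?J + ?K" .
    \<comment> \<open>An infinite normalizer would make \<open>ndens\<close> the null
      measure.\<close>
    have "?J + ?K < \<infinity>"
    proof (rule ccontr)
      assume "\<not> ?thesis"
      then have "(\<integral>\<^sup>+t. ennreal (?f t) \<partial>lborel) = top" unfolding Z by (simp add: less_top[symmetric])
      then have "emeasure (ndens lborel ?f) UNIV = 0" by (subst emeasure_ndens) auto
      then show False using prob_space.emeasure_space_1[OF prob_tau_dens2, of l] by simp
    qed
    then have "ennreal (lo * q / (lo * q + hi)) \<le> ?J / (?J + ?K)"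
      using e lohi q by (intro ennreal_ratio_ge[OF J K]) auto
    also have "\<dots> = emeasure (ndens lborel ?f) {0<..T}"
      unfolding Z[symmetric] by (rule emeasure_ndens[symmetric]) auto
    finally show "ennreal (lo * q / (lo * q + hi)) \<le> emeasure (ndens lborel ?f) {0<..T}" .
  qed
qed

text \<open>With \<open>?v\<close> the fitted vector, the exponent is
  \<open>(2 * (?v \<bullet> y) - ?v \<bullet> ?v) / (2 * s)\<close>. The squares of
  \<open>?v - y\<close> and \<open>?v + y\<close> being nonnegative gives the upper and the lower
  bound.\<close>

lemma tau_dens3_exponent:
  fixes \<beta> l :: "real^'p"
  assumes t: "0 < t" and s: "0 < s"
  defines "E \<equiv> - t * (\<beta> \<bullet> (gram X l *v \<beta>)) / (2 * s) + sqrt t * (\<beta> \<bullet> ((diagm l ** transpose X) *v y)) / s"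
  shows "E \<le> (y \<bullet> y) / (2 * s)"
    "- (t * (norm (X *v hadamard l \<beta>))\<^sup>2 / s + (y \<bullet> y) / (2 * s)) \<le> E"
proof -
  let ?v = "sqrt t *\<^sub>R (X *v hadamard l \<beta>)"
  have "\<beta> \<bullet> ((diagm l ** transpose X) *v y) = (X *v hadamard l \<beta>) \<bullet> y"
    by (simp only: matrix_vector_mul_assoc[symmetric] diagm_mult inner_hadamard[symmetric] inner_matrix_transpose)
  then have E: "E = (2 * (?v \<bullet> y) - ?v \<bullet> ?v) / (2 * s)"
    using t s by (simp add: E_def inner_gram field_simps)
  have "2 * (?v \<bullet> y) - ?v \<bullet> ?v \<le> y \<bullet> y"
    using inner_ge_zero[of "?v - y"] by (simp add: inner_diff_left inner_diff_right inner_commute)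
  then show "E \<le> (y \<bullet> y) / (2 * s)" unfolding E using s by (intro divide_right_mono) auto
  have "- (2 * (?v \<bullet> ?v) + y \<bullet> y) \<le> 2 * (?v \<bullet> y) - ?v \<bullet> ?v"
    using inner_ge_zero[of "?v + y"] by (simp add: inner_add_left inner_add_right inner_commute)
  then have "- (2 * (?v \<bullet> ?v) + y \<bullet> y) / (2 * s) \<le> E" unfolding E using s by (intro divide_right_mono) auto
  moreover have "?v \<bullet> ?v = t * (norm (X *v hadamard l \<beta>))\<^sup>2"
    using t by (simp add: dot_square_norm power_mult_distrib)
  ultimately show "- (t * (norm (X *v hadamard l \<beta>))\<^sup>2 / s + (y \<bullet> y) / (2 * s)) \<le> E"
    using s by (simp add: field_simps)
qed

lemma tau_dens3_total:
  assumes s: "0 < s"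
  shows "(\<integral>\<^sup>+t. ennreal (tau_dens3 y X pt \<beta> s l t) \<partial>lborel) \<le> ennreal (exp ((y \<bullet> y) / (2 * s)))"
    and "prob_space (ndens lborel (tau_dens3 y X pt \<beta> s l))"
proof -
  have "(\<integral>\<^sup>+t. ennreal (tau_dens3 y X pt \<beta> s l t) \<partial>lborel)
    \<le> (\<integral>\<^sup>+t. ennreal (exp ((y \<bullet> y) / (2 * s))) * (ennreal (pt t) * indicator {0<..} t) \<partial>lborel)"
  proof (rule nn_integral_mono)
    fix t
    have "tau_dens3 y X pt \<beta> s l t \<le> exp ((y \<bullet> y) / (2 * s)) * pt t" if "0 < t"
      using that tau_dens3_exponent(1)[OF that s, of \<beta> l] pt0
      by (simp only: tau_dens3_def if_True) (intro mult_right_mono, auto)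
    then show "ennreal (tau_dens3 y X pt \<beta> s l t) \<le> ennreal (exp ((y \<bullet> y) / (2 * s))) * (ennreal (pt t) * indicator {0<..} t)"
      by (cases "0 < t") (auto simp: ennreal_mult[symmetric] pt0 tau_dens3_def intro!: ennreal_leI)
  qed
  also have "\<dots> = ennreal (exp ((y \<bullet> y) / (2 * s))) * 1"
    by (subst nn_integral_cmult) (simp_all add: pt1)
  finally show le: "(\<integral>\<^sup>+t. ennreal (tau_dens3 y X pt \<beta> s l t) \<partial>lborel) \<le> ennreal (exp ((y \<bullet> y) / (2 * s)))"
    by simp
  have "(\<integral>\<^sup>+t. ennreal (tau_dens3 y X pt \<beta> s l t) \<partial>lborel) \<noteq> 0"
    by (rule pt_not_null) (use pt0 in \<open>auto simp: tau_dens3_def less_le\<close>)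
  then show "prob_space (ndens lborel (tau_dens3 y X pt \<beta> s l))"
    using le by (intro prob_ndens) (auto intro: le_less_trans)
qed

lemma tau_dens3_support:
  assumes s: "0 < s" and T: "AE t in lborel. 0 < t \<longrightarrow> pt t \<noteq> 0 \<longrightarrow> t \<le> T"
  shows "1 \<le> emeasure (ndens lborel (tau_dens3 y X pt \<beta> s l)) {0<..T}"
proof -
  have "1 = emeasure (ndens lborel (tau_dens3 y X pt \<beta> s l)) UNIV"
    using prob_space.emeasure_space_1[OF tau_dens3_total(2)[OF s]] by simp
  also have "\<dots> = emeasure (ndens lborel (tau_dens3 y X pt \<beta> s l)) {0<..T}"
  proof (subst (1 2) emeasure_ndens)
    show "(\<integral>\<^sup>+z. ennreal (tau_dens3 y X pt \<beta> s l z) * indicator UNIV z \<partial>lborel) / (\<integral>\<^sup>+z. ennreal (tau_dens3 y X pt \<beta> s l z) \<partial>lborel)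
      = (\<integral>\<^sup>+z. ennreal (tau_dens3 y X pt \<beta> s l z) * indicator {0<..T} z \<partial>lborel) / (\<integral>\<^sup>+z. ennreal (tau_dens3 y X pt \<beta> s l z) \<partial>lborel)"
    proof (rule arg_cong2[where f="(/)", OF nn_integral_cong_AE refl])
      show "AE z in lborel. ennreal (tau_dens3 y X pt \<beta> s l z) * indicator UNIV z
          = ennreal (tau_dens3 y X pt \<beta> s l z) * indicator {0<..T} z"
        using T by eventually_elim (auto simp: tau_dens3_def split: split_indicator)
    qed
  qed auto
  finally show ?thesis by simp
qed

subsection \<open>Drift to the small set and minorization\<close>

definition prior_tau :: "real measure" where
  "prior_tau = density lborel (\<lambda>t. ennreal (pt t) * indicator {0<..} t)"

definition kernel2 :: "real^'p \<Rightarrow> 'p state measure" where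
  "kernel2 l = ndens lborel (tau_dens2 y X a' b' pt l) \<bind> (\<lambda>t. step_c y X a' b' d t l TYPE('n))"

definition kernel3 :: "real^'p \<Rightarrow> real \<Rightarrow> real^'p \<Rightarrow> 'p state measure" where
  "kernel3 \<beta> s l = ndens lborel (tau_dens3 y X pt \<beta> s l) \<bind> (\<lambda>t. step_c y X a' b' d t l TYPE('n))"

text \<open>\<open>kernel2\<close> ignores the old state, so minorizing the law of
  \<open>\<lambda>\<close> suffices for Algorithm 2. \<open>kernel3\<close> still depends on the old
  \<open>\<beta>\<close> and \<open>s\<close>; \<open>kernel_prior\<close>, with the global scale
  drawn from its prior, is the state-free kernel it is compared with.\<close>

definition kernel_prior :: "real^'p \<Rightarrow> 'p state measure" where
  "kernel_prior l = prior_tau \<bind> (\<lambda>t. step_c y X a' b' d t l TYPE('n))"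

lemma sets_prior_tau [simp, measurable_cong]: "sets prior_tau = sets borel"
  by (simp add: prior_tau_def)

lemma prior_tau_positive: "emeasure prior_tau {0<..} = 1"
proof -
  have "emeasure prior_tau {0<..} = (\<integral>\<^sup>+t. ennreal (pt t) * indicator {0<..} t \<partial>lborel)"
    unfolding prior_tau_def
    by (subst emeasure_density) (auto intro!: nn_integral_cong split: split_indicator)
  then show ?thesis by (simp add: pt1)
qed

lemma prob_prior_tau: "prob_space prior_tau"
proof (rule prob_spaceI)
  have "emeasure prior_tau UNIV = (\<integral>\<^sup>+t. ennreal (pt t) * indicator {0<..} t \<partial>lborel)"
    unfolding prior_tau_def by (subst emeasure_density) auto
  then show "emeasure prior_tau (space prior_tau) = 1" by (simp add: pt1 prior_tau_def)
qed

lemma step_c_kernel: "(\<lambda>t. step_c y X a' b' d t l TYPE('n)) \<in> borel \<rightarrow>\<^sub>M subprob_algebra borel"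
  by (rule measurable_step_c) auto

lemma kernel2_meas: "kernel2 \<in> borel \<rightarrow>\<^sub>M subprob_algebra borel"
  unfolding kernel2_def[abs_def]
  apply (rule measurable_bind[OF measurable_tau_dens2], measurable)
  apply (rule measurable_step_c, measurable)
  done

lemma kernel3_meas: "kernel3 \<beta> s \<in> borel \<rightarrow>\<^sub>M subprob_algebra borel"
  unfolding kernel3_def[abs_def]
  apply (rule measurable_bind[OF measurable_tau_dens3], measurable)
  apply (rule measurable_step_c, measurable)
  done

lemma kernel_prior_meas: "kernel_prior \<in> borel \<rightarrow>\<^sub>M subprob_algebra borel"
  unfolding kernel_prior_def[abs_def]
proof (rule measurable_bind[where N=borel])
  show "(\<lambda>l. prior_tau) \<in> borel \<rightarrow>\<^sub>M subprob_algebra borel"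
    using prob_prior_tau by (auto simp: space_subprob_algebra prob_space_imp_subprob_space)
  show "(\<lambda>x. step_c y X a' b' d (snd x) (fst x) TYPE('n)) \<in> borel \<Otimes>\<^sub>M borel \<rightarrow>\<^sub>M subprob_algebra borel"
    by (rule measurable_step_c) auto
qed

lemma alg2_eq: "alg2 y X a' b' d pt pl (\<theta>, \<beta>, s, t, l) = ndens lborel (lam_dens pl d \<theta> \<beta> s t) \<bind> kernel2"
  by (simp add: alg2_def kernel2_def[abs_def])

lemma alg3_eq: "alg3 y X a' b' d pt pl (\<theta>, \<beta>, s, t, l) = ndens lborel (lam_dens pl d \<theta> \<beta> s t) \<bind> kernel3 \<beta> s"
  by (simp add: alg3_def kernel3_def[abs_def])

lemma bind_step_c_state_space:
  assumes "sets M = sets borel" "1 \<le> emeasure M {0<..}"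
  shows "1 \<le> emeasure (M \<bind> (\<lambda>t. step_c y X a' b' d t l TYPE('n))) state_space"
proof -
  have "1 * 1 \<le> emeasure (M \<bind> (\<lambda>t. step_c y X a' b' d t l TYPE('n))) state_space"
    using assms step_c_state_space[OF inv a' b' d pd]
    by (intro emeasure_bind_ge[OF step_c_kernel, where B="{0<..}"] state_space_measurable) auto
  then show ?thesis by simp
qed

text \<open>A bound uniform in \<open>l\<close> survives averaging over any law of
  \<open>\<lambda>\<close>; this is how the entrance probability becomes uniform over all starting
  states.\<close>

lemma lam_bind_ge:
  fixes k :: "real^'p \<Rightarrow> 'p state measure"
  assumes s: "0 < s" and k: "k \<in> borel \<rightarrow>\<^sub>M subprob_algebra borel" and A: "A \<in> sets borel"
    and c: "\<And>l. c \<le> emeasure (k l) A"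
  shows "c \<le> emeasure (ndens lborel (lam_dens pl d \<theta> \<beta> s t) \<bind> k) A"
proof -
  have "1 * c \<le> emeasure (ndens lborel (lam_dens pl d \<theta> \<beta> s t) \<bind> k) A"
    using c by (intro emeasure_bind_ge[OF k, where B=UNIV] A emeasure_UNIV_prob lam_dens_total(2)[OF s]) auto
  then show ?thesis by simp
qed

lemma emeasure_density_bind:
  fixes k :: "real^'p \<Rightarrow> 'p state measure"
  assumes [measurable]: "w \<in> borel_measurable borel" and k [measurable]: "k \<in> borel \<rightarrow>\<^sub>M subprob_algebra borel"
    and A [measurable]: "A \<in> sets borel"
  shows "emeasure (density lborel (\<lambda>l. ennreal (w l)) \<bind> k) A = (\<integral>\<^sup>+l. ennreal (w l) * emeasure (k l) A \<partial>lborel)"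
proof -
  have "emeasure (density lborel (\<lambda>l. ennreal (w l)) \<bind> k) A = (\<integral>\<^sup>+l. emeasure (k l) A \<partial>density lborel (\<lambda>l. ennreal (w l)))"
    by (rule emeasure_bind[where N=borel]) auto
  also have "\<dots> = (\<integral>\<^sup>+l. ennreal (w l) * emeasure (k l) A \<partial>lborel)"
    by (rule nn_integral_density) auto
  finally show ?thesis .
qed

lemma minorizing_measure:
  fixes k :: "real^'p \<Rightarrow> 'p state measure"
  assumes w [measurable]: "w \<in> borel_measurable borel" and k: "k \<in> borel \<rightarrow>\<^sub>M subprob_algebra borel"
    and wpos: "\<And>l. (\<Prod>k\<in>UNIV. pl (l $ k)) \<noteq> 0 \<Longrightarrow> 0 < w l"
    and k1: "\<And>l. 1 \<le> emeasure (k l) state_space"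
  shows "sets (density lborel (\<lambda>l. ennreal (w l)) \<bind> k) = sets borel"
    and "0 < emeasure (density lborel (\<lambda>l. ennreal (w l)) \<bind> k) UNIV"
proof -
  show "sets (density lborel (\<lambda>l. ennreal (w l)) \<bind> k) = sets borel"
    using sets_kernel[OF k] by (intro sets_bind) auto
  have "0 < (\<integral>\<^sup>+l. ennreal (w l) \<partial>lborel)" by (rule tilted_lam_prior_pos) (auto intro: wpos)
  also have "\<dots> \<le> (\<integral>\<^sup>+l. ennreal (w l) * emeasure (k l) UNIV \<partial>lborel)"
  proof (rule nn_integral_mono)
    fix l
    have "1 \<le> emeasure (k l) UNIV"
      using k1[of l] emeasure_mono[of state_space UNIV "k l"] sets_kernel[OF k, of l] by (auto intro: order_trans)
    then show "ennreal (w l) \<le> ennreal (w l) * emeasure (k l) UNIV"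
      using mult_left_mono[of 1 "emeasure (k l) UNIV" "ennreal (w l)"] by simp
  qed
  also have "\<dots> = emeasure (density lborel (\<lambda>l. ennreal (w l)) \<bind> k) UNIV"
    by (rule emeasure_density_bind[OF w k, symmetric]) simp
  finally show "0 < emeasure (density lborel (\<lambda>l. ennreal (w l)) \<bind> k) UNIV" .
qed

lemma lam_bind_minor:
  fixes k :: "real^'p \<Rightarrow> 'p state measure"
  assumes C: "(\<theta>, \<beta>, s, t, l0) \<in> small_set N T" and N: "0 \<le> N"
    and k [measurable]: "k \<in> borel \<rightarrow>\<^sub>M subprob_algebra borel" and A [measurable]: "A \<in> sets borel"
  shows "(\<integral>\<^sup>+l. ennreal (lam_minor N T l) * emeasure (k l) A \<partial>lborel)
    \<le> emeasure (ndens lborel (lam_dens pl d \<theta> \<beta> s t) \<bind> k) A"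
proof -
  have s: "0 < s" using C by (auto simp: small_set_def)
  have "(\<integral>\<^sup>+l. ennreal (lam_minor N T l) * emeasure (k l) A \<partial>lborel)
    \<le> (\<integral>\<^sup>+l. emeasure (k l) A \<partial>ndens lborel (lam_dens pl d \<theta> \<beta> s t))"
    using lam_minor_le[OF C N]
    by (intro nn_integral_density_le_ndens[OF _ _ _ lam_dens_total(1)[OF s]]) auto
  also have "\<dots> = emeasure (ndens lborel (lam_dens pl d \<theta> \<beta> s t) \<bind> k) A"
    by (rule emeasure_bind[symmetric, where N=borel]) auto
  finally show ?thesis .
qed

lemma lam_minor_pos: "(\<Prod>k\<in>UNIV. pl (l $ k)) \<noteq> 0 \<Longrightarrow> 0 < lam_minor N T l"
proof -
  assume "(\<Prod>k\<in>UNIV. pl (l $ k)) \<noteq> 0"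
  then have "0 < pl (l $ k)" for k using pl0[of "l $ k"] by (simp add: less_le)
  then show ?thesis unfolding lam_minor_def by (intro prod_pos) simp
qed

lemma emeasure_kernel_eq_1:
  assumes "K \<in> borel \<rightarrow>\<^sub>M subprob_algebra borel" "1 \<le> emeasure (K x) A"
  shows "emeasure (K x) A = 1"
  using assms subprob_space.subprob_emeasure_le_1[OF subprob_space_kernel[OF assms(1), of x], of A]
  by (intro antisym) auto

lemma start_in_state_space: "(0, 0, 1, 1, 0) \<in> state_space"
  by (simp add: state_space_def)

text \<open>Tightness of the global scale and \<open>step_c_small_set\<close> give the entrance
  probability; the minorizing measure is the mixture of \<open>kernel2\<close> with weight
  \<open>lam_minor\<close>.\<close>

theorem geom_ergodic_alg2: "geom_ergodic (alg2 y X a' b' d pt pl) state_space"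
proof -
  obtain T p :: real where T: "0 < T" and p: "0 < p"
    and pT: "\<And>l. ennreal p \<le> emeasure (ndens lborel (tau_dens2 y X a' b' pt l)) {0<..T}"
    using tau_dens2_tight by blast
  obtain N p' :: real where N: "0 \<le> N" and p': "0 < p'"
    and pC: "\<And>t T l. 0 < t \<Longrightarrow> t \<le> T \<Longrightarrow> ennreal p' \<le> emeasure (step_c y X a' b' d t l TYPE('n)) (small_set N T)"
    using step_c_small_set[OF inv a' b' d pd] by blast
  have K: "alg2 y X a' b' d pt pl \<in> borel \<rightarrow>\<^sub>M subprob_algebra borel"
    by (rule measurable_alg2) auto
  have k1: "1 \<le> emeasure (kernel2 l) state_space" for l
    unfolding kernel2_def by (rule bind_step_c_state_space) (auto simp: tau_dens2_positive)
  have kC: "ennreal p * ennreal p' \<le> emeasure (kernel2 l) (small_set N T)" for l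
    unfolding kernel2_def
    by (rule emeasure_bind_ge[OF step_c_kernel _ _ small_set_measurable pT]) (auto intro: pC)
  show ?thesis
  proof (rule geom_ergodic_small_set[OF K state_space_measurable start_in_state_space _ small_set_measurable])
    fix x :: "'p state" assume x: "x \<in> state_space"
    obtain \<theta> \<beta> s t l where [simp]: "x = (\<theta>, \<beta>, s, t, l)" by (cases x)
    have s: "0 < s" using x by (simp add: state_space_def)
    show "emeasure (alg2 y X a' b' d pt pl x) state_space = 1"
      by (rule emeasure_kernel_eq_1[OF K])
         (simp add: alg2_eq lam_bind_ge[OF s kernel2_meas state_space_measurable k1])
    show "ennreal p * ennreal p' \<le> emeasure (alg2 y X a' b' d pt pl x) (small_set N T)"
      by (simp add: alg2_eq lam_bind_ge[OF s kernel2_meas small_set_measurable kC])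
  next
    show "0 < ennreal p * ennreal p'" using p p' by (simp add: ennreal_zero_less_mult_iff)
    show "sets (density lborel (\<lambda>l. ennreal (lam_minor N T l)) \<bind> kernel2) = sets borel"
      "0 < emeasure (density lborel (\<lambda>l. ennreal (lam_minor N T l)) \<bind> kernel2) UNIV"
      by (rule minorizing_measure[OF lam_minor_meas kernel2_meas lam_minor_pos k1]; assumption)+
  next
    fix x :: "'p state" and A :: "'p state set" assume x: "x \<in> small_set N T" and A: "A \<in> sets borel"
    obtain \<theta> \<beta> s t l where [simp]: "x = (\<theta>, \<beta>, s, t, l)" by (cases x)
    show "emeasure (density lborel (\<lambda>l. ennreal (lam_minor N T l)) \<bind> kernel2) A
        \<le> emeasure (alg2 y X a' b' d pt pl x) A"
      using lam_bind_minor[OF x[simplified] N kernel2_meas A]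
      by (simp add: alg2_eq emeasure_density_bind[OF lam_minor_meas kernel2_meas A])
  qed
qed

text \<open>The constant decays like a Gaussian in \<open>l\<close>, because the exponent contains
  the square of \<open>X *v hadamard l \<beta>\<close>. It need not be uniform in \<open>l\<close>:
  positivity is enough, since it is absorbed into the weight of the minorizing mixture.\<close>

lemma kernel3_minor:
  fixes \<theta> \<beta> l l0 :: "real^'p"
  assumes C: "(\<theta>, \<beta>, s, t, l0) \<in> small_set N T" and N: "0 \<le> N" and T0: "0 < T"
    and T: "AE t in lborel. 0 < t \<longrightarrow> pt t \<noteq> 0 \<longrightarrow> t \<le> T" and A [measurable]: "A \<in> sets borel"
  shows "ennreal (exp (- (T * (onorm ((*v) X))\<^sup>2 * N * (norm l)\<^sup>2 + y \<bullet> y))) * emeasure (kernel_prior l) A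
    \<le> emeasure (kernel3 \<beta> s l) A"
proof -
  let ?L = "onorm ((*v) X)"
  let ?c = "exp (- (T * ?L\<^sup>2 * N * (norm l)\<^sup>2 + y \<bullet> y))"
  let ?g = "\<lambda>t. emeasure (step_c y X a' b' d t l TYPE('n)) A"
  note step_c_kernel[measurable]
  have s: "1 \<le> s" "\<beta> \<bullet> \<beta> \<le> N * s" using C by (auto simp: small_set_def)
  have Z: "(\<integral>\<^sup>+t. ennreal (tau_dens3 y X pt \<beta> s l t) \<partial>lborel) \<le> ennreal (exp ((y \<bullet> y) / 2))"
  proof (rule order_trans[OF tau_dens3_total(1)])
    have "(y \<bullet> y) / (2 * s) \<le> (y \<bullet> y) / 2" using s by (intro divide_left_mono) auto
    then show "ennreal (exp ((y \<bullet> y) / (2 * s))) \<le> ennreal (exp ((y \<bullet> y) / 2))" by (simp add: ennreal_leI)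
  qed (use s in simp)
  have X: "norm (X *v hadamard l \<beta>) \<le> ?L * (norm l * norm \<beta>)"
  proof -
    have "norm (X *v hadamard l \<beta>) \<le> ?L * norm (hadamard l \<beta>)"
      by (rule onorm) (rule matrix_vector_mul_bounded_linear)
    also have "\<dots> \<le> ?L * (norm l * norm \<beta>)"
      by (intro mult_left_mono norm_hadamard_le onorm_pos_le matrix_vector_mul_bounded_linear)
    finally show ?thesis .
  qed
  have X2: "(norm (X *v hadamard l \<beta>))\<^sup>2 \<le> ?L\<^sup>2 * (norm l)\<^sup>2 * (N * s)"
  proof -
    have "(norm (X *v hadamard l \<beta>))\<^sup>2 \<le> (?L * (norm l * norm \<beta>))\<^sup>2"
      by (rule power_mono[OF X]) simp
    also have "\<dots> = ?L\<^sup>2 * (norm l)\<^sup>2 * (\<beta> \<bullet> \<beta>)"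
      by (simp add: power_mult_distrib dot_square_norm)
    also have "\<dots> \<le> ?L\<^sup>2 * (norm l)\<^sup>2 * (N * s)" by (intro mult_left_mono s(2)) simp
    finally show ?thesis .
  qed
  have w: "exp ((y \<bullet> y) / 2) * (?c * (pt t * indicator {0<..} t)) \<le> tau_dens3 y X pt \<beta> s l t"
    if t: "0 < t \<longrightarrow> pt t \<noteq> 0 \<longrightarrow> t \<le> T" for t
  proof (cases "0 < t \<and> pt t \<noteq> 0")
    case True
    then have t': "0 < t" "t \<le> T" using t by auto
    let ?E = "- t * (\<beta> \<bullet> (gram X l *v \<beta>)) / (2 * s) + sqrt t * (\<beta> \<bullet> ((diagm l ** transpose X) *v y)) / s"
    have "t * (norm (X *v hadamard l \<beta>))\<^sup>2 \<le> T * (?L\<^sup>2 * (norm l)\<^sup>2 * (N * s))"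
      using t' T0 by (intro mult_mono X2) auto
    then have "t * (norm (X *v hadamard l \<beta>))\<^sup>2 / s \<le> T * (?L\<^sup>2 * (norm l)\<^sup>2 * (N * s)) / s"
      using s by (intro divide_right_mono) auto
    also have "\<dots> = T * ?L\<^sup>2 * N * (norm l)\<^sup>2" using s by simp
    finally have 1: "t * (norm (X *v hadamard l \<beta>))\<^sup>2 / s \<le> T * ?L\<^sup>2 * N * (norm l)\<^sup>2" .
    have 2: "(y \<bullet> y) / (2 * s) \<le> (y \<bullet> y) / 2" using s by (intro divide_left_mono) auto
    have 3: "- (t * (norm (X *v hadamard l \<beta>))\<^sup>2 / s + (y \<bullet> y) / (2 * s)) \<le> ?E"
      using s t' by (intro tau_dens3_exponent) auto
    \<comment> \<open>One half of \<open>y \<bullet> y\<close> pays for the normalizer bound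
      \<open>exp ((y \<bullet> y) / 2)\<close>, the other for the lower bound of the exponent; both
      use \<open>1 \<le> s\<close>.\<close>
    have "(y \<bullet> y) / 2 + - (T * ?L\<^sup>2 * N * (norm l)\<^sup>2 + y \<bullet> y) \<le> ?E"
      using 1 2 3 by linarith
    then have "exp ((y \<bullet> y) / 2) * ?c \<le> exp ?E"
      unfolding exp_add[symmetric] exp_le_cancel_iff .
    then have "(exp ((y \<bullet> y) / 2) * ?c) * pt t \<le> exp ?E * pt t"
      by (rule mult_right_mono) (rule pt0)
    then show ?thesis using t' by (simp only: tau_dens3_def if_True mult.assoc) simp
  qed (auto simp: tau_dens3_def pt0)
  have wm [measurable]: "(\<lambda>t. ?c * (pt t * indicator {0<..} t)) \<in> borel_measurable borel"
    by measurable
  have "emeasure (kernel_prior l) A = (\<integral>\<^sup>+t. ?g t \<partial>prior_tau)"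
    unfolding kernel_prior_def
    by (rule emeasure_bind[where N=borel]) (auto simp: prior_tau_def)
  also have "\<dots> = (\<integral>\<^sup>+t. (ennreal (pt t) * indicator {0<..} t) * ?g t \<partial>lborel)"
    unfolding prior_tau_def by (rule nn_integral_density) auto
  finally have "ennreal ?c * emeasure (kernel_prior l) A
      = (\<integral>\<^sup>+t. ennreal ?c * ((ennreal (pt t) * indicator {0<..} t) * ?g t) \<partial>lborel)"
    by (simp add: nn_integral_cmult)
  also have "\<dots> = (\<integral>\<^sup>+t. ennreal (?c * (pt t * indicator {0<..} t)) * ?g t \<partial>lborel)"
    by (intro nn_integral_cong) (auto simp: ennreal_mult pt0 mult.assoc split: split_indicator)
  also have "\<dots> \<le> (\<integral>\<^sup>+t. ?g t \<partial>ndens lborel (tau_dens3 y X pt \<beta> s l))"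
  proof (rule nn_integral_density_le_ndens[OF _ _ _ Z])
    show "AE t in lborel. exp ((y \<bullet> y) / 2) * (?c * (pt t * indicator {0<..} t)) \<le> tau_dens3 y X pt \<beta> s l t"
      using T by eventually_elim (rule w)
  qed auto
  also have "\<dots> = emeasure (kernel3 \<beta> s l) A"
    unfolding kernel3_def by (rule emeasure_bind[symmetric, where N=borel]) auto
  finally show ?thesis .
qed

theorem geom_ergodic_alg3:
  assumes T0: "0 < T" and T: "AE t in lborel. 0 < t \<longrightarrow> pt t \<noteq> 0 \<longrightarrow> t \<le> T"
  shows "geom_ergodic (alg3 y X a' b' d pt pl) state_space"
proof -
  obtain N p' :: real where N: "0 \<le> N" and p': "0 < p'"
    and pC: "\<And>t T l. 0 < t \<Longrightarrow> t \<le> T \<Longrightarrow> ennreal p' \<le> emeasure (step_c y X a' b' d t l TYPE('n)) (small_set N T)"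
    using step_c_small_set[OF inv a' b' d pd] by blast
  have K: "alg3 y X a' b' d pt pl \<in> borel \<rightarrow>\<^sub>M subprob_algebra borel"
    by (rule measurable_alg3) auto
  \<comment> \<open>The product of the two losses: minorizing the law of \<open>\<lambda>\<close>,
    and passing from \<open>kernel3\<close> to \<open>kernel_prior\<close>.\<close>
  define w where "w l = lam_minor N T l * exp (- (T * (onorm ((*v) X))\<^sup>2 * N * (norm l)\<^sup>2 + y \<bullet> y))" for l
  have w [measurable]: "w \<in> borel_measurable borel" unfolding w_def by measurable
  have wpos: "0 < w l" if "(\<Prod>k\<in>UNIV. pl (l $ k)) \<noteq> 0" for l
    unfolding w_def using lam_minor_pos[OF that] by simp
  have k1: "1 \<le> emeasure (kernel_prior l) state_space" for l
    unfolding kernel_prior_def by (rule bind_step_c_state_space) (auto simp: prior_tau_positive)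
  show ?thesis
  proof (rule geom_ergodic_small_set[OF K state_space_measurable start_in_state_space _ small_set_measurable])
    fix x :: "'p state" assume x: "x \<in> state_space"
    obtain \<theta> \<beta> s t l where [simp]: "x = (\<theta>, \<beta>, s, t, l)" by (cases x)
    have s: "0 < s" using x by (simp add: state_space_def)
    \<comment> \<open>The bounded support gives the interval full probability, so the entrance
      probability carries a factor 1 where Algorithm 2 has a tightness constant.\<close>
    have sup: "1 \<le> emeasure (ndens lborel (tau_dens3 y X pt \<beta> s l)) {0<..T}" for l
      by (rule tau_dens3_support[OF s T])
    have k1: "1 \<le> emeasure (kernel3 \<beta> s l) state_space" for l
      unfolding kernel3_def
      by (rule bind_step_c_state_space) (auto intro: order_trans[OF sup emeasure_mono])
    have kC: "1 * ennreal p' \<le> emeasure (kernel3 \<beta> s l) (small_set N T)" for l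
      unfolding kernel3_def
      by (rule emeasure_bind_ge[OF step_c_kernel _ _ small_set_measurable sup]) (auto intro: pC)
    show "emeasure (alg3 y X a' b' d pt pl x) state_space = 1"
      by (rule emeasure_kernel_eq_1[OF K])
         (simp add: alg3_eq lam_bind_ge[OF s kernel3_meas state_space_measurable k1])
    show "1 * ennreal p' \<le> emeasure (alg3 y X a' b' d pt pl x) (small_set N T)"
      using lam_bind_ge[OF s kernel3_meas small_set_measurable kC] by (simp add: alg3_eq)
  next
    show "0 < 1 * ennreal p'" using p' by simp
    show "sets (density lborel (\<lambda>l. ennreal (w l)) \<bind> kernel_prior) = sets borel"
      "0 < emeasure (density lborel (\<lambda>l. ennreal (w l)) \<bind> kernel_prior) UNIV"
      by (rule minorizing_measure[OF w kernel_prior_meas wpos k1]; assumption)+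
  next
    fix x :: "'p state" and A :: "'p state set" assume x: "x \<in> small_set N T" and A: "A \<in> sets borel"
    obtain \<theta> \<beta> s t l where [simp]: "x = (\<theta>, \<beta>, s, t, l)" by (cases x)
    have lm: "0 \<le> lam_minor N T l" for l
      unfolding lam_minor_def by (intro prod_nonneg) (simp add: pl0)
    have "emeasure (density lborel (\<lambda>l. ennreal (w l)) \<bind> kernel_prior) A
      = (\<integral>\<^sup>+l. ennreal (w l) * emeasure (kernel_prior l) A \<partial>lborel)"
      by (rule emeasure_density_bind[OF w kernel_prior_meas A])
    also have "\<dots> \<le> (\<integral>\<^sup>+l. ennreal (lam_minor N T l) * emeasure (kernel3 \<beta> s l) A \<partial>lborel)"
    proof (rule nn_integral_mono)
      fix l
      have "ennreal (w l) * emeasure (kernel_prior l) A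
        = ennreal (lam_minor N T l) * (ennreal (exp (- (T * (onorm ((*v) X))\<^sup>2 * N * (norm l)\<^sup>2 + y \<bullet> y)))
            * emeasure (kernel_prior l) A)"
        unfolding w_def ennreal_mult[OF lm exp_ge_zero] by (rule mult.assoc)
      also have "\<dots> \<le> ennreal (lam_minor N T l) * emeasure (kernel3 \<beta> s l) A"
        by (intro mult_left_mono kernel3_minor[OF x[simplified] N T0 T A]) simp
      finally show "ennreal (w l) * emeasure (kernel_prior l) A
        \<le> ennreal (lam_minor N T l) * emeasure (kernel3 \<beta> s l) A" .
    qed
    also have "\<dots> \<le> emeasure (alg3 y X a' b' d pt pl x) A"
      using lam_bind_minor[OF x[simplified] N kernel3_meas A] by (simp add: alg3_eq)
    finally show "emeasure (density lborel (\<lambda>l. ennreal (w l)) \<bind> kernel_prior) A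
        \<le> emeasure (alg3 y X a' b' d pt pl x) A" .
  qed
qed

end

theorem theorem2:
  fixes y :: "real^'n" and X :: "real^'p^'n"
    and a' b' d :: real and pt pl :: "real \<Rightarrow> real"
  assumes "CARD('p) \<le> CARD('n)"
    and "invertible (XtX X)"
    and "0 < a'" and "0 < b'"
    and "\<forall>t. 0 \<le> pt t" and "pt \<in> borel_measurable borel"
    and "(\<integral>\<^sup>+ t\<in>{0<..}. ennreal (pt t) \<partial>lborel) = 1"
    and "\<forall>l. 0 \<le> pl l" and "pl \<in> borel_measurable borel"
    and "(\<integral>\<^sup>+ l. ennreal (pl l) \<partial>lborel) = 1"
    and "0 < d" and "posdef (matrix_inv (XtX X) - d *\<^sub>R mat 1)"
  shows "((\<exists>\<epsilon>>0. (\<integral>\<^sup>+ t\<in>{0<..}. ennreal (t powr \<epsilon> * pt t) \<partial>lborel) < \<infinity>)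
            \<longrightarrow> geom_ergodic (alg2 y X a' b' d pt pl) state_space)
       \<and> ((\<exists>T>0. AE t in lborel. 0 < t \<longrightarrow> pt t \<noteq> 0 \<longrightarrow> t \<le> T)
            \<longrightarrow> geom_ergodic (alg3 y X a' b' d pt pl) state_space)"
proof -
  note A = assms(2,3,4,11,12) assms(5)[rule_format] assms(6,7) assms(8)[rule_format] assms(9,10)
  show ?thesis
    using geom_ergodic_alg2[OF A] geom_ergodic_alg3[OF A] by blast
qed

end
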